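(* Let $\Omega$ be a closed subset of $\mathcal{M}$ equipped with the $\tau$-topology. Assume that $\phi(\Omega,P)<\infty$ and $$\lim_{|x|\to\infty}\frac{\varphi(x)}{|x|}=+\infty .$$ Then there exists at least one $\phi$-projection of $P$ on $\Omega$.
   Context: $(\mathcal{X},\mathcal{B})$ is a measurable space and $P$ a given probability measure on it. $\mathcal{M}$ is the real vector space of all signed finite measures on $(\mathcal{X},\mathcal{B})$, and $\mathcal{M}(P)$ the subspace of those absolutely continuous w.r.t. $P$. The function $\varphi:\mathbb{R}\to[0,+\infty]$ is proper, convex and closed, with $\varphi(1)=0$, and its domain $\{x:\varphi(x)<\infty\}$ is an interval with endpoints $a_\varphi<1<b_\varphi$ (finite or infinite). Closed means that $\varphi(x)\to\varphi(a_\varphi)$ as $x\downarrow a_\varphi$ if $a_\varphi$ is finite, and $\varphi(x)\to\varphi(b_\varphi)$ as $x\uparrow b_\varphi$ if $b_\varphi$ is finite (equivalently, $\varphi$ is lower semi-continuous). For $Q\in\mathcal{M}(P)$ put $\phi(Q,P):=\int_{\mathcal{X}}\varphi\left(\frac{dQ}{dP}\right)dP$, and $\phi(Q,P):=+\infty$ if $Q\in\mathcal{M}\setminus\mathcal{M}(P)$. For $\Omega\subseteq\mathcal{M}$, $\phi(\Omega,P):=\inf_{Q\in\Omega}\phi(Q,P)$. When $\phi(\Omega,P)<\infty$, a $\phi$-projection of $P$ on $\Omega$ is a measure $Q^*\in\Omega$ such that $\phi(Q^*,P)\le\phi(Q,P)$ for all $Q\in\Omega$. The $\tau$-topology on $\mathcal{M}$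 is the weakest topology making all maps $Q\mapsto\int f\,dQ$ continuous, for $f$ a bounded measurable real valued function on $\mathcal{X}$. *)

theory Defs
  imports "HOL-Probability.Probability"
begin

section \<open>Finite signed measures\<close>

text \<open>
  The measurable space is \<open>(space M, sets M)\<close>; the measure carried by \<open>M\<close> plays no role in this
  section. As for \<open>emeasure\<close> in the library, a signed measure takes the value \<open>0\<close> on
  non-measurable sets, so that two signed measures are equal iff they agree on \<open>sets M\<close>.
\<close>

definition signed_measures :: "'a measure \<Rightarrow> ('a set \<Rightarrow> real) set" where
  "signed_measures M = {Q.
     Q {} = 0 \<and>
     (\<forall>A :: nat \<Rightarrow> 'a set. range A \<subseteq> sets M \<longrightarrow> disjoint_family A \<longrightarrow>
        (\<lambda>i. Q (A i)) sums Q (\<Union>i. A i)) \<and>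
     (\<forall>A. A \<notin> sets M \<longrightarrow> Q A = 0)}"

text \<open>
  The parts of the Jordan decomposition: \<open>Q\<^sup>+ A\<close> is the supremum of \<open>Q B\<close> over measurable
  \<open>B \<subseteq> A\<close>. The truncation of negative values by \<open>ennreal\<close> is harmless, as \<open>B = {}\<close> contributes \<open>0\<close>.
\<close>

definition pos_variation :: "'a measure \<Rightarrow> ('a set \<Rightarrow> real) \<Rightarrow> 'a measure" where
  "pos_variation M Q =
     measure_of (space M) (sets M) (\<lambda>A. SUP B \<in> {B \<in> sets M. B \<subseteq> A}. ennreal (Q B))"

definition neg_variation :: "'a measure \<Rightarrow> ('a set \<Rightarrow> real) \<Rightarrow> 'a measure" where
  "neg_variation M Q = pos_variation M (\<lambda>A. - Q A)"

definition signed_integral :: "'a measure \<Rightarrow> ('a set \<Rightarrow> real) \<Rightarrow> ('a \<Rightarrow> real) \<Rightarrow> real" where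
  "signed_integral M Q f =
     (\<integral>x. f x \<partial>pos_variation M Q) - (\<integral>x. f x \<partial>neg_variation M Q)"

section \<open>The \<open>\<tau>\<close>-topology\<close>

definition bounded_measurable :: "'a measure \<Rightarrow> ('a \<Rightarrow> real) set" where
  "bounded_measurable M = {f \<in> borel_measurable M. bounded (f ` space M)}"

definition tau_topology :: "'a measure \<Rightarrow> ('a set \<Rightarrow> real) topology" where
  "tau_topology M = topology_generated_by
     {{Q \<in> signed_measures M. signed_integral M Q f \<in> U} | f U.
        f \<in> bounded_measurable M \<and> open U}"

lemma topspace_tau_topology: "topspace (tau_topology M) = signed_measures M"
proof -
  have "(\<lambda>_. 0) \<in> bounded_measurable M" "open (UNIV :: real set)"
    by (auto simp: bounded_measurable_def image_constant_conv)
  then show ?thesis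
    unfolding tau_topology_def topology_generated_by_topspace by blast
qed

lemma continuous_map_signed_integral:
  assumes "f \<in> bounded_measurable M"
  shows "continuous_map (tau_topology M) euclideanreal (\<lambda>Q. signed_integral M Q f)"
  unfolding continuous_map topspace_tau_topology
proof (intro conjI allI impI)
  fix U :: "real set"
  assume "openin euclideanreal U"
  with assms show "openin (tau_topology M) {Q \<in> signed_measures M. signed_integral M Q f \<in> U}"
    unfolding tau_topology_def by (intro topology_generated_by_Basis) auto
qed auto

lemma tau_topology_weakest:
  assumes "topspace T = signed_measures M"
    and "\<And>f. f \<in> bounded_measurable M \<Longrightarrow>
           continuous_map T euclideanreal (\<lambda>Q. signed_integral M Q f)"
    and "openin (tau_topology M) V"
  shows "openin T V"
proof -
  have "generate_topology_on {{Q \<in> signed_measures M. signed_integral M Q f \<in> U} | f U.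
        f \<in> bounded_measurable M \<and> open U} V"
    using assms(3) unfolding tau_topology_def openin_topology_generated_by_iff .
  then show ?thesis
  proof induction
    case (Basis s)
    then show ?case
      using assms(1,2) by (auto simp: continuous_map)
  qed auto
qed

section \<open>Absolute continuity and \<open>\<phi>\<close>-divergences\<close>

definition signed_abs_cont :: "'a measure \<Rightarrow> ('a set \<Rightarrow> real) \<Rightarrow> bool" where
  "signed_abs_cont P Q \<longleftrightarrow> (\<forall>A \<in> null_sets P. Q A = 0)"

definition signed_RN_deriv :: "'a measure \<Rightarrow> ('a set \<Rightarrow> real) \<Rightarrow> 'a \<Rightarrow> real" where
  "signed_RN_deriv P Q =
     (SOME f. integrable P f \<and> (\<forall>A \<in> sets P. Q A = (LINT x:A|P. f x)))"

definition phi_divergence ::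
    "(real \<Rightarrow> ennreal) \<Rightarrow> ('a set \<Rightarrow> real) \<Rightarrow> 'a measure \<Rightarrow> ennreal" where
  "phi_divergence \<phi> Q P =
     (if signed_abs_cont P Q then \<integral>\<^sup>+ x. \<phi> (signed_RN_deriv P Q x) \<partial>P else \<infinity>)"

definition phi_divergence_set ::
    "(real \<Rightarrow> ennreal) \<Rightarrow> ('a set \<Rightarrow> real) set \<Rightarrow> 'a measure \<Rightarrow> ennreal" where
  "phi_divergence_set \<phi> \<Omega> P = (INF Q \<in> \<Omega>. phi_divergence \<phi> Q P)"

definition is_phi_projection ::
    "(real \<Rightarrow> ennreal) \<Rightarrow> 'a measure \<Rightarrow> ('a set \<Rightarrow> real) set \<Rightarrow> ('a set \<Rightarrow> real) \<Rightarrow> bool" where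
  "is_phi_projection \<phi> P \<Omega> Q \<longleftrightarrow>
     Q \<in> \<Omega> \<and> (\<forall>Q' \<in> \<Omega>. phi_divergence \<phi> Q P \<le> phi_divergence \<phi> Q' P)"

section \<open>Conditions on \<open>\<phi>\<close>\<close>

definition eff_domain :: "(real \<Rightarrow> ennreal) \<Rightarrow> real set" where
  "eff_domain \<phi> = {x. \<phi> x < \<infinity>}"

text \<open>The library's \<open>convex_on\<close> is restricted to real-valued functions.\<close>

definition convex_ennreal :: "(real \<Rightarrow> ennreal) \<Rightarrow> bool" where
  "convex_ennreal \<phi> \<longleftrightarrow>
     (\<forall>x y t. 0 \<le> t \<longrightarrow> t \<le> 1 \<longrightarrow>
        \<phi> ((1 - t) * x + t * y) \<le> ennreal (1 - t) * \<phi> x + ennreal t * \<phi> y)"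

definition interval_with_endpoints :: "real set \<Rightarrow> ereal \<Rightarrow> ereal \<Rightarrow> bool" where
  "interval_with_endpoints S a b \<longleftrightarrow>
     {x. a < ereal x \<and> ereal x < b} \<subseteq> S \<and> S \<subseteq> {x. a \<le> ereal x \<and> ereal x \<le> b}"

text \<open>Each condition is void when the corresponding endpoint is infinite.\<close>

definition closed_at_endpoints :: "(real \<Rightarrow> ennreal) \<Rightarrow> ereal \<Rightarrow> ereal \<Rightarrow> bool" where
  "closed_at_endpoints \<phi> a b \<longleftrightarrow>
     (\<forall>r. a = ereal r \<longrightarrow> (\<phi> \<longlongrightarrow> \<phi> r) (at_right r)) \<and>
     (\<forall>r. b = ereal r \<longrightarrow> (\<phi> \<longlongrightarrow> \<phi> r) (at_left r))"

end

theory Submission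
  imports Defs
begin

text \<open>
  The proof is the direct method: a minimum exists because the sublevel sets of
  \<open>Q \<mapsto> \<phi>(Q, P)\<close> are compact, hence so are their intersections with \<open>\<Omega>\<close>, and these are nested and
  nonempty as long as the level exceeds \<open>\<phi>(\<Omega>, P)\<close>. Compactness here is a form of the
  Dunford--Pettis theorem. It is obtained from Tychonoff's theorem for the pointwise topology on set
  functions.

  The link between the divergence and the pointwise topology is convex duality. A closed convex
  function \<open>\<phi>\<close> is the supremum of countably many affine functions
  (\<open>SUP_countable_affine_minorants\<close>). Therefore, for \<open>c \<ge> 0\<close>, a finitely additive \<open>Q\<close> is a
  signed measure with \<open>\<phi>(Q, P) \<le> c\<close> iff
  \<open>\<Sum>k. s\<^sub>k Q(A\<^sub>k) + t\<^sub>k P(A\<^sub>k) \<le> c\<close> for all finite families of disjoint measurable sets \<open>A\<^sub>k\<close> and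
  affine minorants \<open>s\<^sub>k x + t\<^sub>k\<close> of \<open>\<phi>\<close> (\<open>sublevel_eq_partition_sublevel\<close>). For fixed sets and
  minorants this constrains finitely many values of \<open>Q\<close>, so it survives pointwise limits; this is
  the lower semicontinuity of the divergence.

  Superlinear growth provides minorants of arbitrarily large slope \<open>\<plusminus>m\<close>, and with a single set \<open>A\<close>
  they give \<open>m \<bar>Q(A)\<bar> \<le> c + u P(A)\<close> with \<open>u\<close> depending on \<open>m\<close> only
  (\<open>partition_sublevel_set_bound\<close>). Hence the values of the \<open>Q\<close> in a sublevel set are bounded by a
  common constant, which gives compactness, and \<open>Q(A)\<close> is small when \<open>P(A)\<close> is. The latter makes a
  pointwise limit, which is a priori only finitely additive, countably additive and absolutely
  continuous, so that it has a density by the Radon--Nikodym theorem for signed measures.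

  Finally, on a sublevel set the integral of a bounded function is a uniform limit of finite
  combinations of values \<open>Q(A)\<close>, by rounding the function. So the pointwise topology is there at
  least as fine as the \<open>\<tau>\<close>-topology (\<open>continuous_map_tau_topology\<close>), and \<open>\<Omega>\<close> meets the sublevel
  set in a pointwise closed set.
\<close>

section \<open>Affine minorants of a closed convex function\<close>

text \<open>
  The minorants are real-valued, while \<open>\<phi>\<close> takes values in \<open>[0, \<infinity>]\<close>. Since \<open>ennreal\<close> sends
  negative numbers to \<open>0\<close>, the inequality holds trivially wherever the affine function is negative,
  as it should.
\<close>
definition affine_minorants :: "(real \<Rightarrow> ennreal) \<Rightarrow> (real \<times> real) set" where
  "affine_minorants \<phi> = {(s, t). \<forall>x. ennreal (s * x + t) \<le> \<phi> x}"

lemma affine_minorantsD: "(s, t) \<in> affine_minorants \<phi> \<Longrightarrow> ennreal (s * x + t) \<le> \<phi> x"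
  by (simp add: affine_minorants_def)

lemma zero_affine_minorant: "(0, 0) \<in> affine_minorants \<phi>"
  by (simp add: affine_minorants_def)

text \<open>
  On its domain \<open>\<phi>\<close> is finite, and the theory of real convex functions applies there.
\<close>
lemma convex_on_enn2real:
  assumes "convex_ennreal \<phi>"
  shows "convex_on (eff_domain \<phi>) (\<lambda>x. enn2real (\<phi> x))"
proof -
  have *: "\<phi> ((1 - t) * x + t * y) \<le> ennreal ((1 - t) * enn2real (\<phi> x) + t * enn2real (\<phi> y))"
    if "0 \<le> t" "t \<le> 1" "\<phi> x < \<infinity>" "\<phi> y < \<infinity>" for x y t
  proof -
    have "\<phi> ((1 - t) * x + t * y) \<le> ennreal (1 - t) * \<phi> x + ennreal t * \<phi> y"
      using assms that unfolding convex_ennreal_def by blast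
    also have "\<dots> = ennreal ((1 - t) * enn2real (\<phi> x) + t * enn2real (\<phi> y))"
      using that by (simp add: ennreal_mult' ennreal_plus)
    finally show ?thesis .
  qed
  show ?thesis
  proof (rule convex_onI)
    show "enn2real (\<phi> ((1 - t) *\<^sub>R x + t *\<^sub>R y)) \<le> (1 - t) * enn2real (\<phi> x) + t * enn2real (\<phi> y)"
      if "0 < t" "t < 1" "x \<in> eff_domain \<phi>" "y \<in> eff_domain \<phi>" for t x y
      using that *[of t x y] by (auto intro!: enn2real_leI simp: eff_domain_def)
    show "convex (eff_domain \<phi>)"
      unfolding convex_alt eff_domain_def
    proof (intro ballI allI impI)
      fix x y u assume "x \<in> {x. \<phi> x < \<infinity>}" "y \<in> {x. \<phi> x < \<infinity>}" "0 \<le> u \<and> u \<le> (1::real)"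
      then have "\<phi> ((1 - u) * x + u * y) \<le> ennreal ((1 - u) * enn2real (\<phi> x) + u * enn2real (\<phi> y))"
        by (intro *) auto
      then show "(1 - u) *\<^sub>R x + u *\<^sub>R y \<in> {x. \<phi> x < \<infinity>}"
        by (auto intro: le_less_trans)
    qed
  qed
qed

text \<open>
  At an interior point of its domain the real function has a supporting line with slope the right
  derivative. The line also lies below \<open>\<phi>\<close> off the domain, where \<open>\<phi>\<close> is infinite.
\<close>
lemma supporting_line:
  assumes "convex_ennreal \<phi>" "r \<in> interior (eff_domain \<phi>)"
  obtains s where "(s, enn2real (\<phi> r) - s * r) \<in> affine_minorants \<phi>"
proof -
  define I where "I = eff_domain \<phi>"
  define f where "f = (\<lambda>x. enn2real (\<phi> x))"
  define s where "s = Inf ((\<lambda>t. (f r - f t) / (r - t)) ` ({r<..} \<inter> I))"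
  have f: "ennreal (f y) = \<phi> y" if "y \<in> I" for y
    using that by (simp add: I_def f_def eff_domain_def)
  have "ennreal (s * y + (f r - s * r)) \<le> \<phi> y" for y
  proof (cases "y \<in> I")
    case True
    have "f r + s * (y - r) \<le> f y"
      using convex_le_Inf_differential[OF convex_on_enn2real[OF assms(1)] assms(2), of y] True
      by (simp add: s_def I_def f_def)
    with True show ?thesis
      by (subst f[symmetric]) (auto simp: algebra_simps intro!: ennreal_leI)
  next
    case False
    then have "\<phi> y = top"
      by (simp add: I_def eff_domain_def less_top[symmetric])
    then show ?thesis by simp
  qed
  then show thesis
    by (intro that[of s]) (simp add: affine_minorants_def f_def)
qed

text \<open>
  In the open interval a convex function is continuous; at a finite endpoint the limit is the
  hypothesis of closedness. The value at the endpoint may be infinite.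
\<close>
lemma one_sided_limits:
  assumes "convex_ennreal \<phi>" "interval_with_endpoints (eff_domain \<phi>) a b"
    and "closed_at_endpoints \<phi> a b"
  shows "a \<le> ereal x \<Longrightarrow> ereal x < b \<Longrightarrow> (\<phi> \<longlongrightarrow> \<phi> x) (at_right x)"
    and "a < ereal x \<Longrightarrow> ereal x \<le> b \<Longrightarrow> (\<phi> \<longlongrightarrow> \<phi> x) (at_left x)"
proof -
  have int: "isCont \<phi> x" if "a < ereal x" "ereal x < b"
  proof -
    define I where "I = {x. a < ereal x \<and> ereal x < b}"
    have "open I"
      unfolding I_def by (intro open_Collect_conj open_Collect_less continuous_intros)
    have I: "I \<subseteq> eff_domain \<phi>"
      using assms(2) by (simp add: interval_with_endpoints_def I_def)
    have "convex I"
      unfolding is_interval_convex_1[symmetric] is_interval_1 I_def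
      by (auto intro: less_le_trans le_less_trans[where y = "ereal _"])
    then have "convex_on I (\<lambda>x. enn2real (\<phi> x))"
      using convex_on_enn2real[OF assms(1)] I convex_on_subset by blast
    then have "continuous_on I (\<lambda>x. enn2real (\<phi> x))"
      using \<open>open I\<close> convex_on_continuous by blast
    then have "continuous_on I (\<lambda>x. ennreal (enn2real (\<phi> x)))"
      by (intro continuous_on_ennreal)
    then have "continuous_on I \<phi>"
      using I by (subst continuous_on_cong[OF refl]) (auto simp: eff_domain_def)
    then show ?thesis
      using that \<open>open I\<close> by (simp add: continuous_on_eq_continuous_at I_def)
  qed
  show "(\<phi> \<longlongrightarrow> \<phi> x) (at_right x)" if "a \<le> ereal x" "ereal x < b"
  proof (cases "a = ereal x")
    case True
    with assms(3) show ?thesis by (simp add: closed_at_endpoints_def)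
  next
    case False
    with that int have "isCont \<phi> x" by (simp add: le_less)
    then show ?thesis
      by (simp add: isCont_def filterlim_at_split)
  qed
  show "(\<phi> \<longlongrightarrow> \<phi> x) (at_left x)" if "a < ereal x" "ereal x \<le> b"
  proof (cases "b = ereal x")
    case True
    with assms(3) show ?thesis by (simp add: closed_at_endpoints_def)
  next
    case False
    with that int have "isCont \<phi> x" by (simp add: le_less)
    then show ?thesis
      by (simp add: isCont_def filterlim_at_split)
  qed
qed

text \<open>
  The family consists of supporting lines at the rational points between \<open>a\<close> and \<open>b\<close>, and of lines
  through the finite endpoints whose slopes tend to infinity. The latter are nonpositive on the domain
  and produce the value \<open>\<infinity>\<close> outside its closure.

  In the closure, tangents at rational \<open>r\<close> near \<open>x\<close> have to be nearly exact at \<open>x\<close>, although their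
  slopes may be unbounded as \<open>r\<close> approaches an endpoint. This is avoided by taking \<open>r\<close> between \<open>x\<close>
  and the minimum point \<open>1\<close>: the tangent at \<open>r\<close> is at most \<open>\<phi> 1 = 0\<close> at \<open>1\<close>, so it does not decrease
  from \<open>r\<close> towards \<open>x\<close>, and its value at \<open>x\<close> is at least \<open>\<phi> r\<close>. The latter tends to \<open>\<phi> x\<close> as \<open>r\<close>
  tends to \<open>x\<close>.
\<close>
lemma SUP_countable_affine_minorants:
  assumes "convex_ennreal \<phi>" "\<phi> 1 = 0" "a < 1" "1 < b"
    and dom: "interval_with_endpoints (eff_domain \<phi>) a b"
    and "closed_at_endpoints \<phi> a b"
  obtains C where "countable C" "C \<subseteq> affine_minorants \<phi>"
    "\<And>x. \<phi> x = (SUP (s, t) \<in> C. ennreal (s * x + t))"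
proof -
  have fin: "\<bar>a\<bar> \<noteq> \<infinity> \<or> a = -\<infinity>" "\<bar>b\<bar> \<noteq> \<infinity> \<or> b = \<infinity>"
    using assms(3,4) by auto
  define R where "R = {r \<in> \<rat>. a < ereal r \<and> ereal r < b}"
  have "open {x. a < ereal x \<and> ereal x < b}"
    by (intro open_Collect_conj open_Collect_less continuous_intros)
  with dom have "{x. a < ereal x \<and> ereal x < b} \<subseteq> interior (eff_domain \<phi>)"
    by (intro interior_maximal) (auto simp: interval_with_endpoints_def)
  then have "\<forall>r\<in>R. \<exists>s. (s, enn2real (\<phi> r) - s * r) \<in> affine_minorants \<phi>"
    using supporting_line[OF assms(1)] by (auto simp: R_def) (metis mem_Collect_eq subset_eq)
  then obtain d where d: "\<And>r. r \<in> R \<Longrightarrow> (d r, enn2real (\<phi> r) - d r * r) \<in> affine_minorants \<phi>"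
    by metis
  define T where "T = (\<lambda>r. (d r, enn2real (\<phi> r) - d r * r)) ` R"
  define L where "L = (if a = -\<infinity> then {} else range (\<lambda>n. (- real n, real n * real_of_ereal a)))"
  define U where "U = (if b = \<infinity> then {} else range (\<lambda>n. (real n, - real n * real_of_ereal b)))"
  define C where "C = T \<union> L \<union> U"
  have out: "\<phi> x = top" if "ereal x < a \<or> b < ereal x" for x
    using that dom by (force simp: interval_with_endpoints_def eff_domain_def less_top)
  have "countable R"
    unfolding R_def using countable_rat by (rule countable_subset[rotated]) auto
  then have "countable C"
    by (auto simp: C_def T_def L_def U_def)
  have "L \<subseteq> affine_minorants \<phi>"
  proof (cases "a = -\<infinity>")
    case False
    then obtain l where l: "a = ereal l" using fin by auto
    have "ennreal (- real n * x + real n * l) \<le> \<phi> x" for n x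
    proof (cases "x < l")
      case True
      with out l show ?thesis by simp
    next
      case False
      then have "- real n * x + real n * l \<le> 0" by (simp add: mult_left_mono)
      then show ?thesis by (simp add: ennreal_neg)
    qed
    with l show ?thesis by (auto simp: L_def affine_minorants_def)
  qed (simp add: L_def)
  moreover have "U \<subseteq> affine_minorants \<phi>"
  proof (cases "b = \<infinity>")
    case False
    then obtain l where l: "b = ereal l" using fin by auto
    have "ennreal (real n * x - real n * l) \<le> \<phi> x" for n x
    proof (cases "l < x")
      case True
      with out l show ?thesis by simp
    next
      case False
      then have "real n * x - real n * l \<le> 0" by (simp add: mult_left_mono)
      then show ?thesis by (simp add: ennreal_neg)
    qed
    with l show ?thesis by (auto simp: U_def affine_minorants_def)
  qed (simp add: U_def)
  ultimately have C: "C \<subseteq> affine_minorants \<phi>"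
    using d by (auto simp: C_def T_def)
  have le: "ennreal (s * x + t) \<le> (SUP (s, t) \<in> C. ennreal (s * x + t))" if "(s, t) \<in> C" for s t x
    using that by (intro SUP_upper2[of "(s, t)"]) auto
  have tangent: "\<phi> r \<le> (SUP (s, t) \<in> C. ennreal (s * x + t))"
    if r: "r \<in> R" and side: "x \<le> r \<and> r < 1 \<or> 1 < r \<and> r \<le> x" for r x
  proof -
    have nn: "0 \<le> enn2real (\<phi> r)" by simp
    have "ennreal (d r * 1 + (enn2real (\<phi> r) - d r * r)) \<le> \<phi> 1"
      using d[OF r] by (rule affine_minorantsD)
    then have "d r + (enn2real (\<phi> r) - d r * r) \<le> 0"
      using \<open>\<phi> 1 = 0\<close> by (simp add: ennreal_eq_0_iff)
    then have "d r * (1 - r) \<le> 0" using nn unfolding right_diff_distrib by linarith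
    then have "0 \<le> d r * (x - r)"
      using side by (auto simp: mult_le_0_iff zero_le_mult_iff)
    then have "enn2real (\<phi> r) \<le> d r * x + (enn2real (\<phi> r) - d r * r)"
      by (simp add: algebra_simps)
    moreover have "\<phi> r < top"
      using r dom by (auto simp: R_def interval_with_endpoints_def eff_domain_def)
    ultimately have "\<phi> r \<le> ennreal (d r * x + (enn2real (\<phi> r) - d r * r))"
      by (metis ennreal_enn2real ennreal_leI)
    also have "\<dots> \<le> (SUP (s, t) \<in> C. ennreal (s * x + t))"
      using r by (intro le) (auto simp: C_def T_def)
    finally show ?thesis .
  qed
  have "\<phi> x \<le> (SUP (s, t) \<in> C. ennreal (s * x + t))" for x
  proof (rule dense_le)
    fix y assume y: "y < \<phi> x"
    consider "ereal x < a" | "b < ereal x" | "a \<le> ereal x" "x < 1" | "ereal x \<le> b" "1 < x"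
      using y \<open>\<phi> 1 = 0\<close> by (metis linorder_neqE not_le not_less_zero)
    then show "y \<le> (SUP (s, t) \<in> C. ennreal (s * x + t))"
    proof cases
      case 1
      then obtain l where l: "a = ereal l" "x < l" using fin by auto
      have "y < top" using y by (simp add: less_le_trans)
      then obtain n where n: "enn2real y / (l - x) \<le> real n" using real_arch_simple by blast
      then have "enn2real y \<le> - real n * x + real n * l"
        using l by (simp add: field_simps)
      then have "y \<le> ennreal (- real n * x + real n * l)"
        using \<open>y < top\<close> by (metis ennreal_enn2real ennreal_leI)
      also have "\<dots> \<le> (SUP (s, t) \<in> C. ennreal (s * x + t))"
        using l by (intro le) (auto simp: C_def L_def)
      finally show ?thesis .
    next
      case 2
      then obtain l where l: "b = ereal l" "l < x" using fin by auto
      have "y < top" using y by (simp add: less_le_trans)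
      then obtain n where n: "enn2real y / (x - l) \<le> real n" using real_arch_simple by blast
      then have "enn2real y \<le> real n * x + (- real n * l)"
        using l by (simp add: field_simps)
      then have "y \<le> ennreal (real n * x + (- real n * l))"
        using \<open>y < top\<close> by (metis ennreal_enn2real ennreal_leI)
      also have "\<dots> \<le> (SUP (s, t) \<in> C. ennreal (s * x + t))"
        using l by (intro le) (auto simp: C_def U_def)
      finally show ?thesis .
    next
      case 3
      then have "ereal x < b" using assms(4) by (metis ereal_less(3) less_trans one_ereal_def)
      with 3 have "(\<phi> \<longlongrightarrow> \<phi> x) (at_right x)"
        using one_sided_limits(1)[of \<phi> a b x] assms by (simp add: less_trans)
      then have "eventually (\<lambda>r. y < \<phi> r) (at_right x)"
        using y order_tendstoD(1) by blast
      then obtain z where z: "z > x" "\<And>r. x < r \<Longrightarrow> r < z \<Longrightarrow> y < \<phi> r"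
        by (auto simp: eventually_at_right_field)
      obtain r where r: "r \<in> \<rat>" "x < r" "r < min z 1"
        using Rats_dense_in_real[of x "min z 1"] z 3 by auto
      have "a < ereal r" using 3 r by (metis le_less_trans less_ereal.simps(1))
      moreover have "ereal r < b" using r assms(4) by (metis less_ereal.simps(1) less_trans min_less_iff_conj one_ereal_def)
      ultimately have "r \<in> R" using r by (simp add: R_def)
      then show ?thesis
        using tangent[of r x] z(2)[of r] r by auto
    next
      case 4
      then have "a < ereal x" using assms(3) by (metis less_ereal.simps(1) less_trans one_ereal_def)
      with 4 have "(\<phi> \<longlongrightarrow> \<phi> x) (at_left x)"
        using one_sided_limits(2)[of \<phi> a b x] assms by (simp add: less_trans)
      then have "eventually (\<lambda>r. y < \<phi> r) (at_left x)"
        using y order_tendstoD(1) by blast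
      then obtain z where z: "z < x" "\<And>r. z < r \<Longrightarrow> r < x \<Longrightarrow> y < \<phi> r"
        by (auto simp: eventually_at_left_field)
      obtain r where r: "r \<in> \<rat>" "max z 1 < r" "r < x"
        using Rats_dense_in_real[of "max z 1" x] z 4 by auto
      have "ereal r < b" using 4 r by (metis less_le_trans less_ereal.simps(1))
      moreover have "a < ereal r" using r assms(3) by (metis less_ereal.simps(1) less_trans max_less_iff_conj one_ereal_def)
      ultimately have "r \<in> R" using r by (simp add: R_def)
      then show ?thesis
        using tangent[of r x] z(2)[of r] r by auto
    qed
  qed
  moreover have "(SUP (s, t) \<in> C. ennreal (s * x + t)) \<le> \<phi> x" for x
    using C by (auto intro!: SUP_least dest: affine_minorantsD)
  ultimately show thesis
    using \<open>countable C\<close> C by (intro that[of C]) (auto intro: antisym)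
qed

text \<open>
  If \<open>\<phi> x \<ge> \<bar>m\<bar> \<bar>x\<bar>\<close> for \<open>\<bar>x\<bar> \<ge> R\<close>, then \<open>\<bar>m\<bar> \<bar>x\<bar> - t\<close> is below \<open>\<phi>\<close> for every
  \<open>t \<ge> \<bar>m\<bar> R\<close>: off that range of \<open>x\<close> it is not positive.
\<close>
lemma superlinear_affine_minorants:
  assumes "((\<lambda>x. \<phi> x / ennreal \<bar>x\<bar>) \<longlongrightarrow> \<infinity>) at_infinity"
  obtains t where "(m, - t) \<in> affine_minorants \<phi>" "(- m, - t) \<in> affine_minorants \<phi>" "0 \<le> t"
proof -
  have "eventually (\<lambda>x. ennreal \<bar>m\<bar> < \<phi> x / ennreal \<bar>x\<bar>) at_infinity"
    using assms by (rule order_tendstoD(1)) simp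
  then obtain R where R: "\<And>x. R \<le> \<bar>x\<bar> \<Longrightarrow> ennreal \<bar>m\<bar> < \<phi> x / ennreal \<bar>x\<bar>"
    by (auto simp: eventually_at_infinity)
  \<comment> \<open>The maximum with \<open>1\<close> keeps the quotient \<open>\<phi> x / \<bar>x\<bar>\<close> away from \<open>x = 0\<close>.\<close>
  define t where "t = \<bar>m\<bar> * max 1 R"
  have 1: "ennreal (\<bar>m\<bar> * \<bar>x\<bar> - t) \<le> \<phi> x" for x
  proof (cases "\<bar>x\<bar> \<ge> max 1 R")
    case True
    then have "ennreal \<bar>m\<bar> * ennreal \<bar>x\<bar> \<le> \<phi> x / ennreal \<bar>x\<bar> * ennreal \<bar>x\<bar>"
      using R[of x] by (intro mult_right_mono) auto
    also have "\<dots> = \<phi> x"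
    proof -
      have "\<phi> x / ennreal \<bar>x\<bar> * ennreal \<bar>x\<bar> = \<phi> x * ennreal \<bar>x\<bar> / ennreal \<bar>x\<bar>"
        by (metis ennreal_times_divide mult.commute)
      moreover have "ennreal \<bar>x\<bar> \<noteq> 0"
        using True by (auto simp: ennreal_eq_0_iff)
      ultimately show ?thesis by (simp add: mult_divide_eq_ennreal)
    qed
    finally show ?thesis
      using ennreal_leI[of "\<bar>m\<bar> * \<bar>x\<bar> - t" "\<bar>m\<bar> * \<bar>x\<bar>"] by (simp add: ennreal_mult t_def)
  next
    case False
    then have "\<bar>m\<bar> * \<bar>x\<bar> \<le> t" unfolding t_def by (intro mult_left_mono) linarith+
    then show ?thesis by (simp add: ennreal_neg)
  qed
  have "0 \<le> t" by (simp add: t_def)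
  have 2: "m * x - t \<le> \<bar>m\<bar> * \<bar>x\<bar> - t" "- m * x - t \<le> \<bar>m\<bar> * \<bar>x\<bar> - t" for x
    using abs_ge_self[of "m * x"] abs_ge_minus_self[of "m * x"] by (auto simp: abs_mult)
  have "ennreal (m * x - t) \<le> \<phi> x" "ennreal (- m * x - t) \<le> \<phi> x" for x
    using 1[of x] ennreal_leI[OF 2(1)[of x]] ennreal_leI[OF 2(2)[of x]] by (auto intro: order_trans)
  then show thesis
    unfolding diff_conv_add_uminus
    by (intro that[of t]) (auto simp only: affine_minorants_def mem_Collect_eq case_prod_conv intro: \<open>0 \<le> t\<close>)
qed

section \<open>Finite signed measures\<close>

lemma signed_measuresD:
  assumes "Q \<in> signed_measures M"
  shows signed_measures_empty: "Q {} = 0"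
    and signed_measures_sums: "range A \<subseteq> sets M \<Longrightarrow> disjoint_family A \<Longrightarrow> (\<lambda>i::nat. Q (A i)) sums Q (\<Union>i. A i)"
    and signed_measures_outside: "B \<notin> sets M \<Longrightarrow> Q B = 0"
  using assms by (auto simp: signed_measures_def)

lemma signed_measures_Un:
  assumes "Q \<in> signed_measures M" "A \<in> sets M" "B \<in> sets M" "A \<inter> B = {}"
  shows "Q (A \<union> B) = Q A + Q B"
proof -
  have "(\<lambda>i. Q (binaryset A B i)) sums Q (\<Union>i. binaryset A B i)"
    using assms by (intro signed_measures_sums[OF assms(1)])
      (auto simp: disjoint_family_on_def binaryset_def)
  moreover have "(\<lambda>i. Q (binaryset A B i)) sums (Q A + Q B)"
    using signed_measures_empty[OF assms(1)] by (rule binaryset_sums)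
  ultimately show ?thesis
    by (metis UN_binaryset_eq sums_unique2)
qed

lemma signed_measures_Diff:
  assumes "Q \<in> signed_measures M" "A \<in> sets M" "B \<in> sets M" "B \<subseteq> A"
  shows "Q (A - B) = Q A - Q B"
  using signed_measures_Un[OF assms(1), of "A - B" B] assms by (simp add: Un_absorb2 Diff_disjoint inf_commute)

lemma signed_measures_uminus:
  assumes "Q \<in> signed_measures M"
  shows "(\<lambda>A. - Q A) \<in> signed_measures M"
  using assms by (auto simp: signed_measures_def intro!: sums_minus)

text \<open>
  If \<open>Q\<close> were unbounded on the subsets of \<open>A\<close>, some \<open>B \<subseteq> A\<close> would have \<open>\<bar>Q B\<bar> > \<bar>Q A\<bar> + 1\<close>; then both \<open>B\<close>
  and \<open>A - B\<close> have measure at least \<open>1\<close> in absolute value, and \<open>Q\<close> is unbounded on the subsets of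
  one of them. Passing to that part again and again removes disjoint pieces whose measures do not
  tend to zero, against countable additivity.
\<close>
lemma signed_measures_bounded:
  assumes Q: "Q \<in> signed_measures M"
  obtains C where "\<And>A. \<bar>Q A\<bar> \<le> C"
proof -
  define fin where "fin A \<longleftrightarrow> (\<exists>C. \<forall>B\<in>sets M. B \<subseteq> A \<longrightarrow> \<bar>Q B\<bar> \<le> C)" for A
  have step: "\<exists>B\<in>sets M. B \<subseteq> A \<and> \<not> fin B \<and> 1 \<le> \<bar>Q (A - B)\<bar>"
    if A: "A \<in> sets M" "\<not> fin A" for A
  proof -
    obtain B where B: "B \<in> sets M" "B \<subseteq> A" "\<bar>Q A\<bar> + 1 < \<bar>Q B\<bar>"
      using A unfolding fin_def by (meson not_le)
    have AB: "Q (A - B) = Q A - Q B"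
      using Q A B by (intro signed_measures_Diff)
    have "\<not> fin B \<or> \<not> fin (A - B)"
    proof (rule ccontr)
      assume "\<not> ?thesis"
      then have "fin B" "fin (A - B)" by auto
      then obtain C D where C: "\<forall>E\<in>sets M. E \<subseteq> B \<longrightarrow> \<bar>Q E\<bar> \<le> C"
        and D: "\<forall>E\<in>sets M. E \<subseteq> A - B \<longrightarrow> \<bar>Q E\<bar> \<le> D"
        unfolding fin_def by (elim exE) (rule that)
      have "\<bar>Q E\<bar> \<le> C + D" if "E \<in> sets M" "E \<subseteq> A" for E
      proof -
        have "Q (E \<inter> B \<union> (E - B)) = Q (E \<inter> B) + Q (E - B)"
          using that B by (intro signed_measures_Un[OF Q]) auto
        moreover have "E \<inter> B \<union> (E - B) = E" by auto
        moreover have "\<bar>Q (E \<inter> B)\<bar> \<le> C" "\<bar>Q (E - B)\<bar> \<le> D"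
          using that B by (intro C[rule_format] D[rule_format]; auto)+
        ultimately show ?thesis by simp
      qed
      with A(2) show False unfolding fin_def by blast
    qed
    then show ?thesis
    proof
      assume "\<not> fin B"
      with B AB show ?thesis by (intro bexI[of _ B]) auto
    next
      assume *: "\<not> fin (A - B)"
      have "A - (A - B) = B" using B by auto
      with * B A show ?thesis by (intro bexI[of _ "A - B"]) auto
    qed
  qed
  have "fin (space M)"
  proof (rule ccontr)
    assume *: "\<not> fin (space M)"
    obtain F where F: "\<And>A. A \<in> sets M \<Longrightarrow> \<not> fin A \<Longrightarrow>
        F A \<in> sets M \<and> F A \<subseteq> A \<and> \<not> fin (F A) \<and> 1 \<le> \<bar>Q (A - F A)\<bar>"
      using step by metis
    define S where "S n = (F ^^ n) (space M)" for n
    have S: "S n \<in> sets M \<and> \<not> fin (S n)" for n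
      using * F by (induction n) (auto simp: S_def)
    have "S (Suc n) \<subseteq> S n" for n
      using F[of "S n"] S[of n] by (simp add: S_def)
    then have "S n \<subseteq> S m" if "m \<le> n" for m n
      using that by (rule lift_Suc_antimono_le)
    then have "(S m - S (Suc m)) \<inter> (S n - S (Suc n)) = {}" if "m < n" for m n
      using that Suc_leI by blast
    then have "disjoint_family (\<lambda>n. S n - S (Suc n))"
      unfolding disjoint_family_on_def by (metis inf_commute linorder_neqE_nat)
    then have "(\<lambda>n. Q (S n - S (Suc n))) sums Q (\<Union>n. S n - S (Suc n))"
      using S by (intro signed_measures_sums[OF Q]) auto
    then have "(\<lambda>n. Q (S n - S (Suc n))) \<longlonglongrightarrow> 0"
      using summable_LIMSEQ_zero sums_summable by blast
    then have "eventually (\<lambda>n. \<bar>Q (S n - S (Suc n))\<bar> < 1) sequentially"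
      by (auto simp: tendsto_iff dist_real_def elim!: allE[of _ 1])
    then obtain n where "\<bar>Q (S n - S (Suc n))\<bar> < 1"
      by (auto simp: eventually_sequentially)
    moreover have "1 \<le> \<bar>Q (S n - S (Suc n))\<bar>"
      using F[of "S n"] S[of n] by (simp add: S_def)
    ultimately show False by simp
  qed
  then obtain C where "\<And>B. B \<in> sets M \<Longrightarrow> B \<subseteq> space M \<Longrightarrow> \<bar>Q B\<bar> \<le> C"
    unfolding fin_def by blast
  then have "\<bar>Q A\<bar> \<le> max 0 C" for A
    using sets.sets_into_space[of A M] signed_measures_outside[OF Q, of A]
    by (cases "A \<in> sets M") fastforce+
  then show thesis by (rule that)
qed

lemma space_pos_variation [simp]: "space (pos_variation M Q) = space M"
  by (simp add: pos_variation_def sets.space_closed space_measure_of)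

lemma sets_pos_variation [simp]: "sets (pos_variation M Q) = sets M"
  by (simp add: pos_variation_def)

text \<open>
  The supremum that defines \<open>pos_variation\<close> is countably additive: it is superadditive because
  subsets of disjoint sets can be united, and countably subadditive because a subset of a union is
  cut into pieces.
\<close>
lemma emeasure_pos_variation:
  assumes Q: "Q \<in> signed_measures M" and "A \<in> sets M"
  shows "emeasure (pos_variation M Q) A = (SUP B \<in> {B \<in> sets M. B \<subseteq> A}. ennreal (Q B))"
proof -
  define \<mu> where "\<mu> A = (SUP B \<in> {B \<in> sets M. B \<subseteq> A}. ennreal (Q B))" for A
  have \<mu>_upper: "ennreal (Q B) \<le> \<mu> A" if "B \<in> sets M" "B \<subseteq> A" for A B
    unfolding \<mu>_def using that by (intro SUP_upper) auto
  have \<mu>_least: "\<mu> A \<le> y" if "\<And>B. B \<in> sets M \<Longrightarrow> B \<subseteq> A \<Longrightarrow> ennreal (Q B) \<le> y" for A y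
    unfolding \<mu>_def using that by (intro SUP_least) auto
  have mono: "\<mu> A \<le> \<mu> B" if "A \<subseteq> B" for A B
    using that by (intro \<mu>_least \<mu>_upper) auto
  have superadd: "\<mu> A + \<mu> B \<le> \<mu> (A \<union> B)" if "A \<inter> B = {}" for A B
  proof -
    have "\<mu> A + \<mu> B = (SUP C \<in> {C \<in> sets M. C \<subseteq> A}. SUP D \<in> {D \<in> sets M. D \<subseteq> B}. ennreal (Q C) + ennreal (Q D))"
      unfolding \<mu>_def
      by (subst ennreal_SUP_add_left[symmetric]; (subst ennreal_SUP_add_right)?) auto
    also have "\<dots> \<le> \<mu> (A \<union> B)"
    proof (safe intro!: SUP_least)
      fix C D assume CD: "C \<in> sets M" "C \<subseteq> A" "D \<in> sets M" "D \<subseteq> B"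
      \<comment> \<open>A negative value is truncated to zero, and then the other set alone suffices.\<close>
      consider "Q C \<le> 0" | "Q D \<le> 0" | "0 \<le> Q C" "0 \<le> Q D" by linarith
      then show "ennreal (Q C) + ennreal (Q D) \<le> \<mu> (A \<union> B)"
      proof cases
        case 3
        then have "ennreal (Q C) + ennreal (Q D) = ennreal (Q (C \<union> D))"
          using CD that by (subst signed_measures_Un[OF Q]) auto
        also have "\<dots> \<le> \<mu> (A \<union> B)"
          using CD by (intro \<mu>_upper) auto
        finally show ?thesis .
      qed (use CD in \<open>auto simp: ennreal_neg intro!: \<mu>_upper\<close>)
    qed
    finally show ?thesis .
  qed
  have "countably_additive (sets M) \<mu>"
  proof (rule countably_additiveI)
    fix F :: "nat \<Rightarrow> 'a set"
    assume F: "range F \<subseteq> sets M" "disjoint_family F"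
    show "(\<Sum>i. \<mu> (F i)) = \<mu> (\<Union>i. F i)"
    proof (rule antisym)
      have "(\<Sum>i<n. \<mu> (F i)) \<le> \<mu> (\<Union>i<n. F i)" for n
      proof (induction n)
        case (Suc n)
        have "(\<Sum>i<Suc n. \<mu> (F i)) \<le> \<mu> (\<Union>i<n. F i) + \<mu> (F n)"
          using Suc by (simp add: add_right_mono)
        also have "\<dots> \<le> \<mu> ((\<Union>i<n. F i) \<union> F n)"
        proof (rule superadd)
          have "F i \<inter> F n = {}" if "i < n" for i
            using that by (intro disjoint_family_onD[OF F(2)]) auto
          then show "(\<Union>i<n. F i) \<inter> F n = {}" by blast
        qed
        also have "(\<Union>i<n. F i) \<union> F n = (\<Union>i<Suc n. F i)"
          by (auto simp: less_Suc_eq)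
        finally show ?case .
      qed simp
      also have "\<mu> (\<Union>i<n. F i) \<le> \<mu> (\<Union>i. F i)" for n
        by (intro mono) auto
      finally show "(\<Sum>i. \<mu> (F i)) \<le> \<mu> (\<Union>i. F i)"
        by (intro suminf_le_const) auto
    next
      show "\<mu> (\<Union>i. F i) \<le> (\<Sum>i. \<mu> (F i))"
      proof (rule \<mu>_least)
        fix B assume B: "B \<in> sets M" "B \<subseteq> (\<Union>i. F i)"
        have "(\<lambda>i. Q (B \<inter> F i)) sums Q (\<Union>i. B \<inter> F i)"
          using F B by (intro signed_measures_sums[OF Q])
            (auto simp: disjoint_family_on_def)
        also have "(\<Union>i. B \<inter> F i) = B" using B by auto
        finally have "(\<lambda>n. \<Sum>i<n. Q (B \<inter> F i)) \<longlonglongrightarrow> Q B" by (simp add: sums_def)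
        then have "(\<lambda>n. ennreal (\<Sum>i<n. Q (B \<inter> F i))) \<longlonglongrightarrow> ennreal (Q B)"
          by (intro tendsto_ennrealI)
        moreover have "ennreal (\<Sum>i<n. Q (B \<inter> F i)) \<le> (\<Sum>i. \<mu> (F i))" for n
        proof -
          have "ennreal (\<Sum>i<n. Q (B \<inter> F i)) \<le> ennreal (\<Sum>i<n. max 0 (Q (B \<inter> F i)))"
            by (intro ennreal_leI sum_mono) auto
          also have "\<dots> = (\<Sum>i<n. ennreal (max 0 (Q (B \<inter> F i))))"
            by (subst sum_ennreal) auto
          also have "\<dots> = (\<Sum>i<n. ennreal (Q (B \<inter> F i)))"
            by (intro sum.cong) (auto simp: max_def ennreal_neg)
          also have "\<dots> \<le> (\<Sum>i<n. \<mu> (F i))"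
            using B F by (intro sum_mono \<mu>_upper) auto
          also have "\<dots> \<le> (\<Sum>i. \<mu> (F i))"
            by (rule sum_le_suminf) auto
          finally show ?thesis .
        qed
        ultimately show "ennreal (Q B) \<le> (\<Sum>i. \<mu> (F i))"
          by (intro LIMSEQ_le_const2) auto
      qed
    qed
  qed
  moreover have "positive (sets M) \<mu>"
    using signed_measures_empty[OF Q] by (auto simp: positive_def \<mu>_def intro!: SUP_eq_const)
  ultimately show ?thesis
    unfolding pos_variation_def \<mu>_def[abs_def] using \<open>A \<in> sets M\<close>
    by (intro emeasure_measure_of_sigma) (auto simp: sets.sigma_algebra_axioms)
qed

text \<open>
  The measure \<open>Q\<close> is the difference of the finite measures \<open>Q\<^sup>+\<close> and \<open>Q\<^sup>+ - Q\<close>. Both vanish on the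
  null sets of \<open>P\<close>, because \<open>Q\<close> vanishes on all their measurable subsets, so the theorem for
  positive measures applies to each.
\<close>
lemma signed_Radon_Nikodym:
  assumes "finite_measure P" "Q \<in> signed_measures P" "signed_abs_cont P Q"
  obtains f where "integrable P f" "\<And>A. A \<in> sets P \<Longrightarrow> Q A = (LINT x:A|P. f x)"
proof -
  interpret finite_measure P by fact
  obtain C where C: "\<And>A. \<bar>Q A\<bar> \<le> C"
    using signed_measures_bounded[OF assms(2)] by blast
  define N where "N = pos_variation P Q"
  note N = emeasure_pos_variation[OF assms(2), folded N_def]
  have sets_N: "sets N = sets P" "space N = space P" by (auto simp: N_def)
  have "emeasure N (space P) \<le> ennreal C"
    using abs_le_D1[OF C] by (auto simp: N intro!: SUP_least ennreal_leI)
  then have fin_N: "finite_measure N"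
    by (intro finite_measureI) (auto simp: sets_N top_unique)
  then interpret N: finite_measure N .
  have Q_le: "Q A \<le> measure N A" if "A \<in> sets P" for A
  proof -
    have "ennreal (Q A) \<le> emeasure N A"
      using that by (auto simp: N intro!: SUP_upper)
    then show ?thesis by (simp add: N.emeasure_eq_measure)
  qed
  have ac_N: "emeasure N A = 0" if "A \<in> null_sets P" for A
  proof -
    have "Q B = 0" if "B \<in> sets P" "B \<subseteq> A" for B
      using that \<open>A \<in> null_sets P\<close> assms(3) null_sets_subset[of A P B]
      by (simp add: signed_abs_cont_def)
    moreover have "A \<in> sets P" using that by auto
    ultimately show ?thesis by (auto simp: N intro!: SUP_eq_const)
  qed
  define \<nu> where "\<nu> A = ennreal (measure N A - Q A)" for A
  define N' where "N' = measure_of (space P) (sets P) \<nu>"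
  have sets_N': "sets N' = sets P" "space N' = space P"
    by (auto simp: N'_def space_measure_of sets.space_closed)
  have N': "emeasure N' A = \<nu> A" if "A \<in> sets P" for A
    unfolding N'_def
  proof (rule emeasure_measure_of_sigma)
    show "positive (sets P) \<nu>"
      using signed_measures_empty[OF assms(2)] by (simp add: positive_def \<nu>_def)
    show "countably_additive (sets P) \<nu>"
    proof (rule countably_additiveI)
      fix F :: "nat \<Rightarrow> 'a set"
      assume F: "range F \<subseteq> sets P" "disjoint_family F"
      have "(\<lambda>i. measure N (F i)) sums measure N (\<Union>i. F i)"
        using F by (intro N.finite_measure_UNION) (auto simp: sets_N)
      then have "(\<lambda>i. measure N (F i) - Q (F i)) sums (measure N (\<Union>i. F i) - Q (\<Union>i. F i))"
        using signed_measures_sums[OF assms(2) F] by (rule sums_diff)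
      then show "(\<Sum>i. \<nu> (F i)) = \<nu> (\<Union>i. F i)"
        unfolding \<nu>_def using Q_le F by (intro suminf_ennreal_eq) auto
    qed
  qed (use that in \<open>auto simp: sets.sigma_algebra_axioms\<close>)
  have fin_N': "finite_measure N'"
    by (intro finite_measureI) (auto simp: sets_N' N' \<nu>_def)
  then interpret N': finite_measure N' .
  have "absolutely_continuous P N"
    using ac_N by (auto simp: absolutely_continuous_def null_sets_def sets_N)
  then obtain f where f: "f \<in> borel_measurable P" "density P f = N"
    using Radon_Nikodym_finite_measure[OF fin_N sets_N(1)] by blast
  have "emeasure N' A = 0" if "A \<in> null_sets P" for A
    using that ac_N[OF that] assms(3) null_setsD2[OF that]
    by (simp add: N' \<nu>_def measure_def signed_abs_cont_def)
  then have "absolutely_continuous P N'"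
    by (auto simp: absolutely_continuous_def null_sets_def sets_N')
  then obtain g where g: "g \<in> borel_measurable P" "density P g = N'"
    using Radon_Nikodym_finite_measure[OF fin_N' sets_N'(1)] by blast
  have real_density: "integrable P (\<lambda>x. enn2real (h x)) \<and>
      (\<forall>A\<in>sets P. measure K A = (LINT x:A|P. enn2real (h x)))"
    if h[measurable]: "h \<in> borel_measurable P" and K: "density P h = K" "finite_measure K" for h K
  proof -
    interpret K: finite_measure K by fact
    have K_eq: "emeasure K A = (\<integral>\<^sup>+x. h x * indicator A x \<partial>P)" if "A \<in> sets P" for A
      using that emeasure_density[OF h] K by simp
    have "(\<integral>\<^sup>+x. h x \<partial>P) = emeasure K (space P)"
      by (subst K_eq) (auto intro!: nn_integral_cong)
    then have fin: "(\<integral>\<^sup>+x. h x \<partial>P) < \<infinity>"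
      by (simp add: K.emeasure_eq_measure)
    then have "AE x in P. h x \<noteq> \<infinity>"
      by (intro nn_integral_noteq_infinite) auto
    then have ae: "AE x in P. ennreal (enn2real (h x)) = h x"
      by eventually_elim (simp add: less_top)
    have int: "integrable P (\<lambda>x. enn2real (h x))"
    proof (rule integrableI_nonneg)
      show "(\<integral>\<^sup>+x. ennreal (enn2real (h x)) \<partial>P) < \<infinity>"
        using fin by (subst nn_integral_cong_AE[OF ae])
    qed auto
    moreover have "measure K A = (LINT x:A|P. enn2real (h x))" if [measurable]: "A \<in> sets P" for A
    proof -
      have "(LINT x:A|P. enn2real (h x)) = (\<integral>x. enn2real (h x * indicator A x) \<partial>P)"
        unfolding set_lebesgue_integral_def by (intro Bochner_Integration.integral_cong) (auto simp: indicator_def)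
      also have "\<dots> = enn2real (\<integral>\<^sup>+x. ennreal (enn2real (h x * indicator A x)) \<partial>P)"
        by (subst integral_eq_nn_integral) auto
      also have "(\<integral>\<^sup>+x. ennreal (enn2real (h x * indicator A x)) \<partial>P) = emeasure K A"
        unfolding K_eq[OF that] using ae
        by (intro nn_integral_cong_AE) (auto elim!: eventually_mono simp: indicator_def)
      finally show ?thesis by (simp add: measure_def)
    qed
    ultimately show ?thesis by blast
  qed
  note F = real_density[OF f fin_N] and G = real_density[OF g fin_N']
  show thesis
  proof (rule that)
    show "integrable P (\<lambda>x. enn2real (f x) - enn2real (g x))"
      using F G by auto
    fix A assume A: "A \<in> sets P"
    then have "Q A = measure N A - measure N' A"
      using Q_le[OF A] by (simp add: measure_def[of N'] N' \<nu>_def)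
    also have "\<dots> = (LINT x:A|P. enn2real (f x)) - (LINT x:A|P. enn2real (g x))"
      using A F G by simp
    also have "\<dots> = (LINT x:A|P. enn2real (f x) - enn2real (g x))"
      using A F G by (intro set_integral_diff(2)[symmetric])
        (auto simp: set_integrable_def intro!: integrable_mult_indicator simp del: real_scaleR_def)
    finally show "Q A = (LINT x:A|P. enn2real (f x) - enn2real (g x))" .
  qed
qed

section \<open>Signed measures with a density\<close>

definition has_density :: "'a measure \<Rightarrow> ('a set \<Rightarrow> real) \<Rightarrow> ('a \<Rightarrow> real) \<Rightarrow> bool" where
  "has_density P Q f \<longleftrightarrow> integrable P f \<and> (\<forall>A \<in> sets P. Q A = (LINT x:A|P. f x))"

lemma has_densityD:
  assumes "has_density P Q f"
  shows has_density_integrable: "integrable P f"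
    and has_density_eq: "A \<in> sets P \<Longrightarrow> Q A = (LINT x|P. indicator A x * f x)"
  using assms by (auto simp: has_density_def set_lebesgue_integral_def)

lemma has_density_integrable_indicator:
  "has_density P Q f \<Longrightarrow> A \<in> sets P \<Longrightarrow> integrable P (\<lambda>x. indicator A x * f x :: real)"
  using integrable_mult_indicator[of A P f] by (simp add: has_density_def)

lemma has_density_uminus: "has_density P Q f \<Longrightarrow> has_density P (\<lambda>A. - Q A) (\<lambda>x. - f x)"
  by (auto simp: has_density_def set_lebesgue_integral_def)

lemma has_density_signed_RN_deriv:
  assumes "finite_measure P" "Q \<in> signed_measures P" "signed_abs_cont P Q"
  shows "has_density P Q (signed_RN_deriv P Q)"
proof -
  have "\<exists>f. integrable P f \<and> (\<forall>A \<in> sets P. Q A = (LINT x:A|P. f x))"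
    using signed_Radon_Nikodym[OF assms] by metis
  then show ?thesis
    unfolding has_density_def signed_RN_deriv_def by (rule someI_ex)
qed

text \<open>
  The supremum of \<open>Q B\<close> over \<open>B \<subseteq> A\<close> is attained at \<open>B = A \<inter> {f \<ge> 0}\<close>. The density of the positive
  part appears as \<open>ennreal \<circ> f\<close>, since \<open>ennreal\<close> truncates negative values.
\<close>
lemma pos_variation_density:
  assumes Q: "Q \<in> signed_measures P" and f: "has_density P Q f"
  shows "pos_variation P Q = density P (\<lambda>x. ennreal (f x))"
proof (rule measure_eqI)
  note int = has_density_integrable_indicator[OF f]
  have [measurable]: "f \<in> borel_measurable P"
    using has_density_integrable[OF f] by simp
  fix A assume "A \<in> sets (pos_variation P Q)"
  then have A[measurable]: "A \<in> sets P" by simp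
  have "(SUP B \<in> {B \<in> sets P. B \<subseteq> A}. ennreal (Q B)) = (\<integral>\<^sup>+x. ennreal (f x) * indicator A x \<partial>P)"
  proof (rule SUP_eqI)
    fix B assume "B \<in> {B \<in> sets P. B \<subseteq> A}"
    then have B: "B \<in> sets P" "B \<subseteq> A" by auto
    have "Q B \<le> (\<integral>x. max 0 (indicator B x * f x) \<partial>P)"
      unfolding has_density_eq[OF f B(1)] using int[OF B(1)]
      by (intro integral_mono) auto
    then have "ennreal (Q B) \<le> ennreal (\<integral>x. max 0 (indicator B x * f x) \<partial>P)"
      by (rule ennreal_leI)
    also have "\<dots> = (\<integral>\<^sup>+x. ennreal (max 0 (indicator B x * f x)) \<partial>P)"
      using int[OF B(1)] by (intro nn_integral_eq_integral[symmetric]) auto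
    also have "\<dots> \<le> (\<integral>\<^sup>+x. ennreal (f x) * indicator A x \<partial>P)"
      using B by (intro nn_integral_mono) (auto simp: indicator_def max_def)
    finally show "ennreal (Q B) \<le> (\<integral>\<^sup>+x. ennreal (f x) * indicator A x \<partial>P)" .
  next
    fix y assume y: "\<And>B. B \<in> {B \<in> sets P. B \<subseteq> A} \<Longrightarrow> ennreal (Q B) \<le> y"
    define B where "B = {x \<in> space P. 0 \<le> f x} \<inter> A"
    have B: "B \<in> sets P" by (simp add: B_def)
    have "(\<integral>\<^sup>+x. ennreal (f x) * indicator A x \<partial>P) = (\<integral>\<^sup>+x. ennreal (indicator B x * f x) \<partial>P)"
      by (intro nn_integral_cong) (auto simp: B_def indicator_def ennreal_neg)
    also have "\<dots> = ennreal (Q B)"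
      unfolding has_density_eq[OF f B] using int[OF B]
      by (intro nn_integral_eq_integral) (auto simp: B_def indicator_def)
    also have "\<dots> \<le> y"
      using B by (intro y) (auto simp: B_def)
    finally show "(\<integral>\<^sup>+x. ennreal (f x) * indicator A x \<partial>P) \<le> y" .
  qed
  then show "emeasure (pos_variation P Q) A = emeasure (density P (\<lambda>x. ennreal (f x))) A"
    using A by (simp add: emeasure_pos_variation[OF Q] emeasure_density)
qed simp

lemma signed_integral_density:
  assumes Q: "Q \<in> signed_measures P" and f: "has_density P Q f"
    and g: "g \<in> bounded_measurable P"
  shows "integrable P (\<lambda>x. g x * f x)" "signed_integral P Q g = (\<integral>x. g x * f x \<partial>P)"
proof -
  have [measurable]: "g \<in> borel_measurable P" and "bounded (g ` space P)"
    using g by (auto simp: bounded_measurable_def)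
  then obtain K where K: "\<And>x. x \<in> space P \<Longrightarrow> \<bar>g x\<bar> \<le> K"
    by (auto simp: bounded_iff)
  have int_f: "integrable P f" using has_density_integrable[OF f] .
  then have [measurable]: "f \<in> borel_measurable P" by simp
  have int: "integrable P (\<lambda>x. g x * h x)" if h: "integrable P h" for h
  proof (rule Bochner_Integration.integrable_bound)
    show "integrable P (\<lambda>x. K * h x)" using h by simp
    show "(\<lambda>x. g x * h x) \<in> borel_measurable P" using h by measurable
    show "AE x in P. norm (g x * h x) \<le> norm (K * h x)"
    proof (rule AE_I2)
      fix x assume "x \<in> space P"
      then have "\<bar>g x\<bar> \<le> \<bar>K\<bar>" using K by (meson abs_ge_self order_trans)
      then show "norm (g x * h x) \<le> norm (K * h x)"
        by (simp add: abs_mult mult_right_mono)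
    qed
  qed
  show "integrable P (\<lambda>x. g x * f x)" using int[OF int_f] .
  have part: "(\<integral>x. g x \<partial>density P (\<lambda>x. ennreal (h x))) = (\<integral>x. g x * max 0 (h x) \<partial>P)"
    if [measurable]: "h \<in> borel_measurable P" for h
  proof -
    have "density P (\<lambda>x. ennreal (h x)) = density P (\<lambda>x. ennreal (max 0 (h x)))"
      by (intro density_cong) (auto simp: max_def ennreal_neg)
    moreover have "(\<integral>x. g x \<partial>density P (\<lambda>x. ennreal (max 0 (h x)))) = (\<integral>x. max 0 (h x) *\<^sub>R g x \<partial>P)"
      by (intro integral_density) auto
    ultimately show ?thesis
      by (simp add: mult.commute)
  qed
  have "signed_integral P Q g = (\<integral>x. g x * max 0 (f x) \<partial>P) - (\<integral>x. g x * max 0 (- f x) \<partial>P)"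
    using pos_variation_density[OF Q f]
      pos_variation_density[OF signed_measures_uminus[OF Q] has_density_uminus[OF f]]
    by (simp add: signed_integral_def neg_variation_def part)
  also have "\<dots> = (\<integral>x. g x * max 0 (f x) - g x * max 0 (- f x) \<partial>P)"
    using int_f by (intro Bochner_Integration.integral_diff[symmetric] int) auto
  also have "\<dots> = (\<integral>x. g x * f x \<partial>P)"
    by (intro Bochner_Integration.integral_cong) (auto simp: max_def)
  finally show "signed_integral P Q g = (\<integral>x. g x * f x \<partial>P)" .
qed

lemma integral_abs_density_le:
  assumes f: "has_density P Q f" and C: "\<And>A. \<bar>Q A\<bar> \<le> C"
  shows "(\<integral>x. \<bar>f x\<bar> \<partial>P) \<le> 2 * C"
proof -
  have [measurable]: "f \<in> borel_measurable P"
    using has_density_integrable[OF f] by simp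
  define A B where "A = {x \<in> space P. 0 \<le> f x}" and "B = {x \<in> space P. f x < 0}"
  have AB: "A \<in> sets P" "B \<in> sets P" by (simp_all add: A_def B_def)
  have "(\<integral>x. \<bar>f x\<bar> \<partial>P) = (\<integral>x. indicator A x * f x - indicator B x * f x \<partial>P)"
    by (intro Bochner_Integration.integral_cong) (auto simp: A_def B_def indicator_def)
  also have "\<dots> = Q A - Q B"
    unfolding has_density_eq[OF f AB(1)] has_density_eq[OF f AB(2)]
    using AB by (intro Bochner_Integration.integral_diff has_density_integrable_indicator[OF f])
  also have "\<dots> \<le> 2 * C" using abs_le_D1[OF C[of A]] abs_le_D2[OF C[of B]] by simp
  finally show ?thesis .
qed

text \<open>
  Rounding \<open>g\<close> down to multiples of \<open>e\<close> changes its integral by at most \<open>e\<close> times the total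
  variation. The sets \<open>A j\<close> and the index set \<open>J\<close> depend on \<open>g\<close> and \<open>e\<close> only, so the approximation is
  uniform over all \<open>Q\<close> with a common bound \<open>C\<close>.
\<close>
lemma signed_integral_simple_approximation:
  fixes e :: real
  assumes g: "g \<in> bounded_measurable P" and "0 < e"
  obtains J :: "int set" and A where "finite J" "\<And>j. A j \<in> sets P"
    "\<And>Q f C. Q \<in> signed_measures P \<Longrightarrow> has_density P Q f \<Longrightarrow> (\<And>A. \<bar>Q A\<bar> \<le> C) \<Longrightarrow>
       \<bar>signed_integral P Q g - (\<Sum>j\<in>J. e * j * Q (A j))\<bar> \<le> e * (2 * C)"
proof -
  have [measurable]: "g \<in> borel_measurable P" and "bounded (g ` space P)"
    using g by (auto simp: bounded_measurable_def)
  then obtain K where K: "\<And>x. x \<in> space P \<Longrightarrow> \<bar>g x\<bar> \<le> K"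
    by (auto simp: bounded_iff)
  define A where "A j = {x \<in> space P. \<lfloor>g x / e\<rfloor> = j}" for j
  define J where "J = {\<lfloor>- K / e\<rfloor>..\<lfloor>K / e\<rfloor>}"
  have A: "A j \<in> sets P" for j by (simp add: A_def)
  have round: "(\<Sum>j\<in>J. e * j * indicator (A j) x) = e * \<lfloor>g x / e\<rfloor>" if "x \<in> space P" for x
  proof -
    have "- K / e \<le> g x / e" "g x / e \<le> K / e"
      using abs_le_D1[OF K[OF that]] abs_le_D2[OF K[OF that]] \<open>0 < e\<close>
      by (auto intro!: divide_right_mono simp del: minus_divide_left[symmetric])
    then have J: "\<lfloor>g x / e\<rfloor> \<in> J"
      by (auto simp: J_def intro!: floor_mono)
    have "(\<Sum>j\<in>J. e * j * indicator (A j) x) = (\<Sum>j\<in>J. if j = \<lfloor>g x / e\<rfloor> then e * j else 0)"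
      using that by (intro sum.cong) (auto simp: A_def indicator_def)
    also have "\<dots> = e * \<lfloor>g x / e\<rfloor>"
      using J by (simp add: J_def)
    finally show ?thesis .
  qed
  have "\<bar>signed_integral P Q g - (\<Sum>j\<in>J. e * j * Q (A j))\<bar> \<le> e * (2 * C)"
    if Q: "Q \<in> signed_measures P" and f: "has_density P Q f" and C: "\<And>A. \<bar>Q A\<bar> \<le> C" for Q f C
  proof -
    have int_f: "integrable P f" using has_density_integrable[OF f] .
    note int = has_density_integrable_indicator[OF f A]
    have ints: "integrable P (\<lambda>x. \<Sum>j\<in>J. e * j * (indicator (A j) x * f x))"
      using int by (intro Bochner_Integration.integrable_sum integrable_mult_right) auto
    have "(\<Sum>j\<in>J. e * j * Q (A j)) = (\<integral>x. (\<Sum>j\<in>J. e * j * (indicator (A j) x * f x)) \<partial>P)"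
      using int has_density_eq[OF f A] by simp
    then have "signed_integral P Q g - (\<Sum>j\<in>J. e * j * Q (A j)) =
        (\<integral>x. g x * f x - (\<Sum>j\<in>J. e * j * (indicator (A j) x * f x)) \<partial>P)"
      using signed_integral_density[OF Q f g] ints by simp
    also have "\<bar>\<dots>\<bar> \<le> (\<integral>x. \<bar>g x * f x - (\<Sum>j\<in>J. e * j * (indicator (A j) x * f x))\<bar> \<partial>P)"
      by (rule integral_abs_bound)
    also have "\<dots> \<le> (\<integral>x. e * \<bar>f x\<bar> \<partial>P)"
    proof (rule integral_mono)
      show "integrable P (\<lambda>x. \<bar>g x * f x - (\<Sum>j\<in>J. e * j * (indicator (A j) x * f x))\<bar>)"
        using signed_integral_density(1)[OF Q f g] ints by simp
      show "integrable P (\<lambda>x. e * \<bar>f x\<bar>)" using int_f by simp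
      fix x assume x: "x \<in> space P"
      have "(\<Sum>j\<in>J. e * j * (indicator (A j) x * f x)) = e * \<lfloor>g x / e\<rfloor> * f x"
        unfolding round[OF x, symmetric] sum_distrib_right by (simp add: mult.assoc)
      then have "\<bar>g x * f x - (\<Sum>j\<in>J. e * j * (indicator (A j) x * f x))\<bar> = \<bar>g x - e * \<lfloor>g x / e\<rfloor>\<bar> * \<bar>f x\<bar>"
        by (simp add: left_diff_distrib flip: abs_mult)
      also have "g x - e * \<lfloor>g x / e\<rfloor> = e * frac (g x / e)"
        using \<open>0 < e\<close> by (simp add: frac_def field_simps)
      also have "\<bar>\<dots>\<bar> \<le> e"
        using \<open>0 < e\<close> frac_ge_0[of "g x / e"] less_imp_le[OF frac_lt_1[of "g x / e"]]
        by (simp add: abs_mult mult_left_le)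
      finally show "\<bar>g x * f x - (\<Sum>j\<in>J. e * j * (indicator (A j) x * f x))\<bar> \<le> e * \<bar>f x\<bar>"
        by (simp add: mult_right_mono)
    qed
    also have "\<dots> = e * (\<integral>x. \<bar>f x\<bar> \<partial>P)" by simp
    also have "\<dots> \<le> e * (2 * C)"
      using \<open>0 < e\<close> integral_abs_density_le[OF f C] by (intro mult_left_mono) auto
    finally show ?thesis .
  qed
  then show thesis
    using A by (intro that[of J A]) (auto simp: J_def)
qed

section \<open>Sublevel sets of the divergence\<close>

definition sublevel :: "(real \<Rightarrow> ennreal) \<Rightarrow> 'a measure \<Rightarrow> real \<Rightarrow> ('a set \<Rightarrow> real) set" where
  "sublevel \<phi> P c = {Q \<in> signed_measures P. phi_divergence \<phi> Q P \<le> ennreal c}"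

text \<open>
  The dual description of \<open>sublevel\<close>. Every condition involves only finitely many values of \<open>Q\<close>, which
  makes the set visibly closed under pointwise limits. Countable additivity and absolute continuity
  do not have this form; they follow from the inequalities when \<open>\<phi>\<close> grows superlinearly.
\<close>
definition partition_sublevel :: "(real \<Rightarrow> ennreal) \<Rightarrow> 'a measure \<Rightarrow> real \<Rightarrow> ('a set \<Rightarrow> real) set" where
  "partition_sublevel \<phi> P c = {Q.
     (\<forall>B. B \<notin> sets P \<longrightarrow> Q B = 0) \<and>
     (\<forall>A B. A \<in> sets P \<longrightarrow> B \<in> sets P \<longrightarrow> A \<inter> B = {} \<longrightarrow> Q (A \<union> B) = Q A + Q B) \<and>
     (\<forall>n A s t. range A \<subseteq> sets P \<longrightarrow> disjoint_family A \<longrightarrow>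
        (\<forall>k. (s k, t k) \<in> affine_minorants \<phi>) \<longrightarrow>
        (\<Sum>k<(n::nat). s k * Q (A k) + t k * measure P (A k)) \<le> c)}"

lemma partition_sublevelD:
  fixes n :: nat
  assumes "Q \<in> partition_sublevel \<phi> P c" "range A \<subseteq> sets P" "disjoint_family A"
    and "\<And>k. (s k, t k) \<in> affine_minorants \<phi>"
  shows "(\<Sum>k<n. s k * Q (A k) + t k * measure P (A k)) \<le> c"
  using assms unfolding partition_sublevel_def mem_Collect_eq by blast

text \<open>
  The type of set functions carries the product topology, that is, the topology of pointwise
  convergence.
\<close>
lemma closed_partition_sublevel: "closed (partition_sublevel \<phi> P c)"
  unfolding partition_sublevel_def
  by (intro closed_Collect_conj closed_Collect_all closed_Collect_imp open_Collect_const
      closed_Collect_le closed_Collect_eq continuous_intros continuous_on_product_coordinates)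

lemma (in finite_measure) integral_partition:
  fixes n :: nat
  assumes f: "has_density M Q f" and A: "range A \<subseteq> sets M"
  shows "integrable M (\<lambda>x. \<Sum>k<n. indicator (A k) x * (s k * f x + t k) :: real)"
    and "(\<integral>x. (\<Sum>k<n. indicator (A k) x * (s k * f x + t k)) \<partial>M) =
      (\<Sum>k<n. s k * Q (A k) + t k * measure M (A k))"
proof -
  have A: "A k \<in> sets M" for k using A by auto
  have *: "indicator (A k) x * (s k * f x + t k) = s k * (indicator (A k) x * f x) + t k * indicator (A k) x" for k x
    by (simp add: algebra_simps)
  have int: "integrable M (\<lambda>x. s k * (indicator (A k) x * f x))"
    "integrable M (\<lambda>x. t k * indicator (A k) x)" for k
    using has_density_integrable_indicator[OF f A] A
    by (auto intro!: integrable_mult_right simp: emeasure_eq_measure)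
  show "integrable M (\<lambda>x. \<Sum>k<n. indicator (A k) x * (s k * f x + t k) :: real)"
    unfolding * by (intro Bochner_Integration.integrable_sum Bochner_Integration.integrable_add int)
  have "(\<integral>x. (\<Sum>k<n. indicator (A k) x * (s k * f x + t k)) \<partial>M) =
      (\<Sum>k<n. (\<integral>x. s k * (indicator (A k) x * f x) \<partial>M) + (\<integral>x. t k * indicator (A k) x \<partial>M))"
    unfolding * using int
    by (subst Bochner_Integration.integral_sum) (auto intro!: sum.cong Bochner_Integration.integral_add)
  also have "\<dots> = (\<Sum>k<n. s k * Q (A k) + t k * measure M (A k))"
    using A has_density_eq[OF f A] by (simp add: sets.Int_space_eq2)
  finally show "(\<integral>x. (\<Sum>k<n. indicator (A k) x * (s k * f x + t k)) \<partial>M) =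
      (\<Sum>k<n. s k * Q (A k) + t k * measure M (A k))" .
qed

lemma sum_disjoint_indicator:
  fixes j n :: nat
  assumes "disjoint_family A" "j < n" "x \<in> A j"
  shows "(\<Sum>k<n. indicator (A k) x * g k) = (g j :: real)"
proof -
  have "x \<notin> A k" if "k \<noteq> j" for k
    using disjoint_family_onD[OF assms(1), of k j] that assms(3) by auto
  then have "(\<Sum>k<n. indicator (A k) x * g k) = (\<Sum>k<n. if k = j then g k else 0)"
    using assms(3) by (intro sum.cong) auto
  with assms(2) show ?thesis by simp
qed

text \<open>
  The sum is the integral of a function that is at most \<open>\<phi> \<circ> f\<close>: on \<open>A k\<close> it is an affine minorant of
  \<open>\<phi>\<close> evaluated at \<open>f\<close>, and off the sets \<open>A k\<close> it is \<open>0\<close>.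
\<close>
lemma (in finite_measure) partition_sum_le_divergence:
  fixes n :: nat
  assumes f: "has_density M Q f" and le: "(\<integral>\<^sup>+x. \<phi> (f x) \<partial>M) \<le> ennreal c" and "0 \<le> c"
    and A: "range A \<subseteq> sets M" "disjoint_family A" and st: "\<And>k. (s k, t k) \<in> affine_minorants \<phi>"
  shows "(\<Sum>k<n. s k * Q (A k) + t k * measure M (A k)) \<le> c"
proof -
  define L where "L x = (\<Sum>k<n. indicator (A k) x * (s k * f x + t k))" for x
  have int: "integrable M L"
    using integral_partition(1)[OF f A(1)] by (simp add: L_def[abs_def])
  have "ennreal (L x) \<le> \<phi> (f x)" for x
  proof (cases "\<exists>j<n. x \<in> A j")
    case True
    then obtain j where "j < n" "x \<in> A j" by blast
    then have "L x = s j * f x + t j"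
      unfolding L_def by (rule sum_disjoint_indicator[OF A(2)])
    then show ?thesis using affine_minorantsD[OF st[of j]] by simp
  next
    case False
    then have "L x = 0" by (auto simp: L_def intro!: sum.neutral)
    then show ?thesis by simp
  qed
  then have "(\<integral>\<^sup>+x. ennreal (max 0 (L x)) \<partial>M) \<le> (\<integral>\<^sup>+x. \<phi> (f x) \<partial>M)"
    by (intro nn_integral_mono) (auto simp: max_def)
  then have "ennreal (\<integral>x. max 0 (L x) \<partial>M) \<le> ennreal c"
    using int le by (subst nn_integral_eq_integral[symmetric]) auto
  then have "(\<integral>x. max 0 (L x) \<partial>M) \<le> c" using \<open>0 \<le> c\<close> by simp
  moreover have "(\<integral>x. L x \<partial>M) \<le> (\<integral>x. max 0 (L x) \<partial>M)"
    using int by (intro integral_mono) auto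
  ultimately show ?thesis
    using integral_partition(2)[OF f A(1), where n = n and s = s and t = t] by (simp add: L_def)
qed

text \<open>
  What the compactness argument uses of \<open>\<phi>\<close>. The lines of the envelope are enumerated starting with
  the zero function, so that the maximum of the first few lines is never negative and agrees with
  its truncation by \<open>ennreal\<close>.
\<close>
locale affine_envelope = prob_space P for P :: "'a measure" +
  fixes \<phi> :: "real \<Rightarrow> ennreal" and s t :: "nat \<Rightarrow> real"
  assumes zero_line: "s 0 = 0" "t 0 = 0"
    and envelope: "\<phi> x = (SUP k. ennreal (s k * x + t k))"
    and steep_lines: "\<exists>u\<ge>0. (m, - u) \<in> affine_minorants \<phi> \<and> (- m, - u) \<in> affine_minorants \<phi>"
begin

lemma lines_affine_minorants: "(s k, t k) \<in> affine_minorants \<phi>"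
  by (auto simp: affine_minorants_def envelope intro: SUP_upper)

text \<open>
  The maximum \<open>m n\<close> of the first lines, evaluated at the density, increases to \<open>\<phi> \<circ> f\<close>. Cutting the
  space according to which line attains the maximum turns the integral of \<open>m n\<close> into one of the
  sums that are at most \<open>c\<close>; then monotone convergence applies.
\<close>
lemma divergence_le_if_partition_sums_le:
  assumes f: "has_density P Q f" and "Q \<in> partition_sublevel \<phi> P c"
  shows "(\<integral>\<^sup>+x. \<phi> (f x) \<partial>P) \<le> ennreal c"
proof -
  have [measurable]: "f \<in> borel_measurable P"
    using has_density_integrable[OF f] by simp
  define l where "l k x = s k * f x + t k" for k x
  have [measurable]: "l k \<in> borel_measurable P" for k
    by (simp add: l_def[abs_def])
  define m where "m n x = Max ((\<lambda>k. l k x) ` {..n})" for n x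
  have [measurable]: "m n \<in> borel_measurable P" for n
    unfolding m_def by measurable
  have l_le_m: "l k x \<le> m n x" if "k \<le> n" for k n x
    unfolding m_def using that by (intro Max_ge) auto
  have m_eq: "\<exists>k\<le>n. l k x = m n x" for n x
    unfolding m_def using Max_in[of "(\<lambda>k. l k x) ` {..n}"] by (auto simp: image_iff)
  have m_mono: "m i x \<le> m j x" if "i \<le> j" for i j x
    unfolding m_def using that by (intro Max_mono) auto
  have m_nonneg: "0 \<le> m n x" for n x
    using l_le_m[of 0 n x] by (simp add: l_def zero_line)
  have \<phi>_f: "\<phi> (f x) = (SUP n. ennreal (m n x))" for x
  proof (rule antisym)
    show "\<phi> (f x) \<le> (SUP n. ennreal (m n x))"
      unfolding envelope
    proof (rule SUP_mono)
      fix k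
      show "\<exists>n\<in>UNIV. ennreal (s k * f x + t k) \<le> ennreal (m n x)"
        using l_le_m[of k k x] by (auto simp: l_def intro!: ennreal_leI exI[of _ k])
    qed
    show "(SUP n. ennreal (m n x)) \<le> \<phi> (f x)"
    proof (rule SUP_least)
      fix n
      obtain k where "l k x = m n x" using m_eq by blast
      then show "ennreal (m n x) \<le> \<phi> (f x)"
        using affine_minorantsD[OF lines_affine_minorants[of k], of "f x"] by (simp add: l_def)
    qed
  qed
  have "(\<integral>\<^sup>+x. ennreal (m n x) \<partial>P) \<le> ennreal c" for n
  proof -
    \<comment> \<open>Ties are broken in favour of the first line, to make the sets disjoint.\<close>
    define A where "A k = (if k \<le> n then {x \<in> space P. l k x = m n x \<and> (\<forall>j<k. l j x < m n x)} else {})" for k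
    have A: "range A \<subseteq> sets P" "disjoint_family A"
      by (auto simp: A_def disjoint_family_on_def) (metis linorder_neqE_nat order_less_irrefl)
    have m_sum: "m n x = (\<Sum>k<Suc n. indicator (A k) x * (s k * f x + t k))" if x: "x \<in> space P" for x
    proof -
      define j where "j = (LEAST k. l k x = m n x)"
      obtain k where k: "k \<le> n" "l k x = m n x" using m_eq by blast
      have j: "l j x = m n x" "j \<le> k"
        unfolding j_def using k by (auto intro: LeastI Least_le)
      have "l i x < m n x" if "i < j" for i
        using not_less_Least[of i "\<lambda>k. l k x = m n x"] l_le_m[of i n x] that j k
        by (auto simp: j_def[symmetric] less_le)
      then have "x \<in> A j" using j k x by (auto simp: A_def)
      with j k have "(\<Sum>k<Suc n. indicator (A k) x * l k x) = l j x"
        by (intro sum_disjoint_indicator[OF A(2)]) auto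
      with j show ?thesis by (simp add: l_def)
    qed
    note I = integral_partition[OF f A(1), where n = "Suc n" and s = s and t = t]
    have "(\<integral>\<^sup>+x. ennreal (m n x) \<partial>P) =
        (\<integral>\<^sup>+x. ennreal (\<Sum>k<Suc n. indicator (A k) x * (s k * f x + t k)) \<partial>P)"
      using m_sum by (intro nn_integral_cong) simp
    also have "\<dots> = ennreal (\<Sum>k<Suc n. s k * Q (A k) + t k * measure P (A k))"
      unfolding I(2)[symmetric]
    proof (intro nn_integral_eq_integral I(1) AE_I2)
      show "0 \<le> (\<Sum>k<Suc n. indicator (A k) x * (s k * f x + t k))" if "x \<in> space P" for x
        unfolding m_sum[OF that, symmetric] by (rule m_nonneg)
    qed
    also have "\<dots> \<le> ennreal c"
      using assms(2) A lines_affine_minorants by (intro ennreal_leI partition_sublevelD)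
    finally show ?thesis .
  qed
  then have "(SUP n. \<integral>\<^sup>+x. ennreal (m n x) \<partial>P) \<le> ennreal c"
    by (rule SUP_least)
  also have "(SUP n. \<integral>\<^sup>+x. ennreal (m n x) \<partial>P) = (\<integral>\<^sup>+x. \<phi> (f x) \<partial>P)"
    unfolding \<phi>_f by (intro nn_integral_monotone_convergence_SUP[symmetric])
      (auto simp: incseq_def le_fun_def intro!: ennreal_leI m_mono)
  finally show ?thesis .
qed

text \<open>
  The defining inequality with the single set \<open>A\<close> and the minorants of slope \<open>m\<close> and \<open>- m\<close>. The
  constant \<open>u\<close> is uniform in \<open>Q\<close>, \<open>c\<close> and \<open>A\<close>.
\<close>
lemma partition_sublevel_set_bound:
  obtains u where "0 \<le> u"
    "\<And>Q c A. Q \<in> partition_sublevel \<phi> P c \<Longrightarrow> A \<in> sets P \<Longrightarrow> m * \<bar>Q A\<bar> \<le> c + u * prob A"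
proof -
  obtain u where u: "0 \<le> u" "(m, - u) \<in> affine_minorants \<phi>" "(- m, - u) \<in> affine_minorants \<phi>"
    using steep_lines by blast
  have "m * \<bar>Q A\<bar> \<le> c + u * prob A"
    if Q: "Q \<in> partition_sublevel \<phi> P c" and A: "A \<in> sets P" for Q c A
  proof -
    have *: "s' * Q A - u * prob A \<le> c" if "(s', - u) \<in> affine_minorants \<phi>" for s'
    proof -
      \<comment> \<open>The inequality is stated for sequences of sets; here all but the first are empty.\<close>
      have "(\<Sum>k<1. s' * Q (if k = 0 then A else {}) + (- u) * prob (if k = (0::nat) then A else {})) \<le> c"
        using that A by (intro partition_sublevelD[OF Q]) (auto simp: disjoint_family_on_def)
      then show ?thesis by simp
    qed
    show ?thesis
      using *[OF u(2)] *[OF u(3)] by (cases "0 \<le> Q A") auto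
  qed
  with u(1) show thesis by (intro that[of u])
qed

lemma partition_sublevel_nonneg:
  assumes "Q \<in> partition_sublevel \<phi> P c"
  shows "0 \<le> c"
proof -
  have "(\<Sum>k<(0::nat). 0 * Q {} + 0 * prob {}) \<le> c"
    using zero_affine_minorant[of \<phi>]
    by (intro partition_sublevelD[OF assms]) (auto simp: disjoint_family_on_def)
  then show ?thesis by simp
qed

lemma partition_sublevel_bounded:
  obtains C where "\<And>Q A. Q \<in> partition_sublevel \<phi> P c \<Longrightarrow> \<bar>Q A\<bar> \<le> C"
proof -
  obtain u where u: "0 \<le> u"
    "\<And>Q c A. Q \<in> partition_sublevel \<phi> P c \<Longrightarrow> A \<in> sets P \<Longrightarrow> 1 * \<bar>Q A\<bar> \<le> c + u * prob A"
    using partition_sublevel_set_bound[of 1] by blast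
  have "\<bar>Q A\<bar> \<le> c + u" if Q: "Q \<in> partition_sublevel \<phi> P c" for Q A
  proof (cases "A \<in> sets P")
    case True
    then have "\<bar>Q A\<bar> \<le> c + u * prob A" using u(2)[OF Q] by simp
    also have "\<dots> \<le> c + u" using u(1) by (simp add: mult_left_le)
    finally show ?thesis .
  next
    case False
    then have "Q A = 0" using Q by (simp add: partition_sublevel_def)
    then show ?thesis using partition_sublevel_nonneg[OF Q] u(1) by simp
  qed
  then show thesis by (rule that)
qed

text \<open>
  In \<open>\<bar>Q A\<bar> \<le> c / m + (u / m) P(A)\<close> the slope \<open>m\<close> is chosen first, to make \<open>c / m\<close> small; then \<open>P(A)\<close> has to
  be small enough.
\<close>
lemma partition_sublevel_absolutely_continuous:
  assumes Q: "Q \<in> partition_sublevel \<phi> P c" and B: "range B \<subseteq> sets P"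
    and lim: "(\<lambda>i::nat. prob (B i)) \<longlonglongrightarrow> 0"
  shows "(\<lambda>i. Q (B i)) \<longlonglongrightarrow> 0"
proof (rule tendstoI)
  fix e :: real assume "0 < e"
  have c: "0 \<le> c" using partition_sublevel_nonneg[OF Q] .
  define m where "m = (c + 1) / e"
  have m: "0 < m" using c \<open>0 < e\<close> by (simp add: m_def)
  obtain u where "0 \<le> u"
    "\<And>Q c A. Q \<in> partition_sublevel \<phi> P c \<Longrightarrow> A \<in> sets P \<Longrightarrow> m * \<bar>Q A\<bar> \<le> c + u * prob A"
    by (rule partition_sublevel_set_bound[of m]) blast
  then have u: "m * \<bar>Q (B i)\<bar> \<le> c + u * prob (B i)" for i
    using Q B by (simp add: range_subsetD)
  have "(\<lambda>i. u * prob (B i)) \<longlonglongrightarrow> u * 0" by (intro tendsto_intros lim)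
  then have "eventually (\<lambda>i. u * prob (B i) < 1) sequentially"
    by (simp add: order_tendstoD(2))
  then show "eventually (\<lambda>i. dist (Q (B i)) 0 < e) sequentially"
  proof eventually_elim
    case (elim i)
    then have "m * \<bar>Q (B i)\<bar> < c + 1" using u[of i] by linarith
    also have "c + 1 = m * e" using \<open>0 < e\<close> by (simp add: m_def)
    finally show ?case using m by (simp add: dist_real_def)
  qed
qed

text \<open>
  Finite additivity together with \<open>Q R \<rightarrow> 0\<close> for the tails \<open>R\<close> of a disjoint union gives countable
  additivity. For a null set, the constant sequence shows that \<open>Q\<close> vanishes on it.
\<close>
lemma partition_sublevel_signed_measures:
  assumes Q: "Q \<in> partition_sublevel \<phi> P c"
  shows "Q \<in> signed_measures P" "signed_abs_cont P Q"
proof -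
  have add: "Q (A \<union> B) = Q A + Q B" if "A \<in> sets P" "B \<in> sets P" "A \<inter> B = {}" for A B
    using Q that by (simp add: partition_sublevel_def)
  have empty: "Q {} = 0" using add[of "{}" "{}"] by simp
  show "signed_abs_cont P Q"
    unfolding signed_abs_cont_def
  proof
    fix A assume "A \<in> null_sets P"
    then have "(\<lambda>i::nat. Q A) \<longlonglongrightarrow> 0"
      by (intro partition_sublevel_absolutely_continuous[OF Q]) (auto simp: measure_eq_0_null_sets)
    then show "Q A = 0" by (simp add: LIMSEQ_const_iff)
  qed
  have "(\<lambda>i. Q (A i)) sums Q (\<Union>i. A i)" if A: "range A \<subseteq> sets P" "disjoint_family A" for A :: "nat \<Rightarrow> 'a set"
  proof -
    have meas: "(\<Union>i<n. A i) \<in> sets P" "(\<Union>i. A i) \<in> sets P" for n using A(1) by auto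
    have disj: "(\<Union>i<n. A i) \<inter> A n = {}" for n
      using disjoint_family_onD[OF A(2), of _ n] by fastforce
    have sum: "(\<Sum>i<n. Q (A i)) = Q (\<Union>i<n. A i)" for n
    proof (induction n)
      case (Suc n)
      have "Q ((\<Union>i<n. A i) \<union> A n) = Q (\<Union>i<n. A i) + Q (A n)"
        using A(1) meas disj by (intro add) auto
      then show ?case using Suc by (simp add: lessThan_Suc Un_commute)
    qed (simp add: empty)
    define R where "R n = (\<Union>i. A i) - (\<Union>i<n. A i)" for n
    have R: "range R \<subseteq> sets P" using meas by (auto simp: R_def)
    have tail: "Q (\<Union>i. A i) - Q (R n) = (\<Sum>i<n. Q (A i))" for n
    proof -
      have "(\<Union>i<n. A i) \<union> R n = (\<Union>i. A i)" by (auto simp: R_def)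
      moreover have "Q ((\<Union>i<n. A i) \<union> R n) = Q (\<Union>i<n. A i) + Q (R n)"
        using meas R by (intro add) (auto simp: R_def)
      ultimately show ?thesis by (simp add: sum)
    qed
    have "(\<lambda>n. \<Sum>i<n. prob (A i)) \<longlonglongrightarrow> prob (\<Union>i. A i)"
      using finite_measure_UNION[OF A] by (simp add: sums_def)
    then have "(\<lambda>n. prob (\<Union>i. A i) - (\<Sum>i<n. prob (A i))) \<longlonglongrightarrow> prob (\<Union>i. A i) - prob (\<Union>i. A i)"
      by (intro tendsto_intros)
    moreover have "prob (R n) = prob (\<Union>i. A i) - (\<Sum>i<n. prob (A i))" for n
    proof -
      have "prob (\<Union>i<n. A i) = (\<Sum>i<n. prob (A i))"
        using A by (intro finite_measure_finite_Union) (auto intro: disjoint_family_on_mono[of _ UNIV])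
      then show ?thesis
        unfolding R_def using meas by (subst finite_measure_Diff) auto
    qed
    ultimately have "(\<lambda>n. Q (R n)) \<longlonglongrightarrow> 0"
      by (intro partition_sublevel_absolutely_continuous[OF Q R]) simp
    then have "(\<lambda>n. Q (\<Union>i. A i) - Q (R n)) \<longlonglongrightarrow> Q (\<Union>i. A i) - 0"
      by (intro tendsto_intros)
    then show ?thesis by (simp add: sums_def tail)
  qed
  then show "Q \<in> signed_measures P"
    using Q empty by (auto simp: signed_measures_def partition_sublevel_def)
qed

lemma sublevel_eq_partition_sublevel:
  assumes "0 \<le> c"
  shows "sublevel \<phi> P c = partition_sublevel \<phi> P c"
proof (intro equalityI subsetI)
  fix Q assume Q: "Q \<in> sublevel \<phi> P c"
  then have Q: "Q \<in> signed_measures P" "signed_abs_cont P Q"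
    and le: "(\<integral>\<^sup>+x. \<phi> (signed_RN_deriv P Q x) \<partial>P) \<le> ennreal c"
    by (auto simp: sublevel_def phi_divergence_def top_unique split: if_splits)
  note f = has_density_signed_RN_deriv[OF finite_measure_axioms Q]
  show "Q \<in> partition_sublevel \<phi> P c"
    unfolding partition_sublevel_def mem_Collect_eq
    by (intro conjI allI impI signed_measures_outside[OF Q(1)] signed_measures_Un[OF Q(1)]
        partition_sum_le_divergence[OF f le assms]) auto
next
  fix Q assume "Q \<in> partition_sublevel \<phi> P c"
  note Q = this partition_sublevel_signed_measures[OF this]
  note f = has_density_signed_RN_deriv[OF finite_measure_axioms Q(2,3)]
  show "Q \<in> sublevel \<phi> P c"
    using Q divergence_le_if_partition_sums_le[OF f Q(1)] by (simp add: sublevel_def phi_divergence_def)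
qed

text \<open>
  A closed subset of a product of compact intervals, by Tychonoff's theorem.
\<close>
lemma compact_partition_sublevel: "compact (partition_sublevel \<phi> P c)"
proof -
  obtain C where C: "\<And>Q A. Q \<in> partition_sublevel \<phi> P c \<Longrightarrow> \<bar>Q A\<bar> \<le> C"
    using partition_sublevel_bounded by blast
  have "compactin (product_topology (\<lambda>_. euclidean) UNIV) (PiE UNIV (\<lambda>_::'a set. {-C..C}))"
    unfolding compactin_PiE by simp
  then have "compact (PiE UNIV (\<lambda>_::'a set. {-C..C}))"
    by (simp add: euclidean_product_topology)
  then have "compact (PiE UNIV (\<lambda>_. {-C..C}) \<inter> partition_sublevel \<phi> P c)"
    using closed_partition_sublevel by (rule compact_Int_closed)
  moreover have "-C \<le> Q A" "Q A \<le> C" if "Q \<in> partition_sublevel \<phi> P c" for Q A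
    using C[OF that, of A] by auto
  then have "partition_sublevel \<phi> P c \<subseteq> PiE UNIV (\<lambda>_. {-C..C})"
    by auto
  ultimately show ?thesis
    by (simp add: inf_absorb2)
qed

text \<open>
  Each value \<open>Q A\<close> is a continuous function of \<open>Q\<close> for the pointwise topology, so each integral is a
  uniform limit of continuous functions on the sublevel set.
\<close>
lemma continuous_map_tau_topology:
  "continuous_map (top_of_set (partition_sublevel \<phi> P c)) (tau_topology P) (\<lambda>Q. Q)"
proof -
  let ?S = "partition_sublevel \<phi> P c"
  obtain C where C: "\<And>Q A. Q \<in> ?S \<Longrightarrow> \<bar>Q A\<bar> \<le> C"
    using partition_sublevel_bounded by blast
  have cont: "continuous_on ?S (\<lambda>Q. signed_integral P Q g)" if g: "g \<in> bounded_measurable P" for g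
  proof -
    have "\<exists>h. continuous_on ?S h \<and>
        (\<forall>Q\<in>?S. \<bar>signed_integral P Q g - h Q\<bar> \<le> 1 / real (Suc n) * (2 * C))" for n
    proof -
      obtain J :: "int set" and A where JA: "finite J" "\<And>j. A j \<in> sets P"
        "\<And>Q f C. Q \<in> signed_measures P \<Longrightarrow> has_density P Q f \<Longrightarrow> (\<And>A. \<bar>Q A\<bar> \<le> C) \<Longrightarrow>
          \<bar>signed_integral P Q g - (\<Sum>j\<in>J. 1 / real (Suc n) * j * Q (A j))\<bar> \<le> 1 / real (Suc n) * (2 * C)"
        using signed_integral_simple_approximation[OF g, of "1 / real (Suc n)"] by auto
      have "continuous_on ?S (\<lambda>Q. \<Sum>j\<in>J. 1 / real (Suc n) * j * Q (A j))"
        by (intro continuous_intros continuous_on_subset[OF continuous_on_product_coordinates]) auto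
      moreover have "\<bar>signed_integral P Q g - (\<Sum>j\<in>J. 1 / real (Suc n) * j * Q (A j))\<bar> \<le> 1 / real (Suc n) * (2 * C)"
        if Q: "Q \<in> ?S" for Q
        using partition_sublevel_signed_measures[OF Q] C[OF Q]
        by (intro JA(3)[OF _ has_density_signed_RN_deriv[OF finite_measure_axioms]])
      ultimately show ?thesis by blast
    qed
    then obtain h where h: "\<And>n. continuous_on ?S (h n)"
      "\<And>n Q. Q \<in> ?S \<Longrightarrow> \<bar>signed_integral P Q g - h n Q\<bar> \<le> 1 / real (Suc n) * (2 * C)"
      by metis
    have lim: "(\<lambda>n. 1 / real (Suc n) * (2 * C)) \<longlonglongrightarrow> 0 * (2 * C)"
      by (intro tendsto_intros LIMSEQ_Suc[OF lim_1_over_n])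
    have "uniform_limit ?S h (\<lambda>Q. signed_integral P Q g) sequentially"
    proof (rule uniform_limitI)
      fix e :: real assume "0 < e"
      then have "eventually (\<lambda>n. 1 / real (Suc n) * (2 * C) < e) sequentially"
        using lim by (intro order_tendstoD(2)[OF lim]) simp
      then show "\<forall>\<^sub>F n in sequentially. \<forall>Q\<in>?S. dist (h n Q) (signed_integral P Q g) < e"
      proof eventually_elim
        case (elim n)
        show ?case
          using h(2)[of _ n] elim by (auto simp: dist_real_def abs_minus_commute intro: le_less_trans)
      qed
    qed
    then show ?thesis
      using h(1) by (intro uniform_limit_theorem[where F = sequentially]) auto
  qed
  have sub: "?S \<subseteq> signed_measures P" using partition_sublevel_signed_measures by blast
  show ?thesis
    unfolding tau_topology_def continuous_on_generated_topo_iff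
  proof (intro conjI allI impI)
    fix W assume "W \<in> {{Q \<in> signed_measures P. signed_integral P Q f \<in> U} |f U. f \<in> bounded_measurable P \<and> open U}"
    then obtain g U where gU: "W = {Q \<in> signed_measures P. signed_integral P Q g \<in> U}"
      "g \<in> bounded_measurable P" "open U" by blast
    have "openin (top_of_set ?S) (?S \<inter> (\<lambda>Q. signed_integral P Q g) -` U)"
      using cont[OF gU(2)] gU(3) continuous_openin_preimage_gen by blast
    also have "?S \<inter> (\<lambda>Q. signed_integral P Q g) -` U = (\<lambda>Q. Q) -` W \<inter> topspace (top_of_set ?S)"
      using sub by (auto simp: gU(1))
    finally show "openin (top_of_set ?S) ((\<lambda>Q. Q) -` W \<inter> topspace (top_of_set ?S))" .
  next
    show "(\<lambda>Q. Q) ` topspace (top_of_set ?S) \<subseteq>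
        \<Union> {{Q \<in> signed_measures P. signed_integral P Q f \<in> U} |f U. f \<in> bounded_measurable P \<and> open U}"
      using sub topspace_tau_topology[of P]
      unfolding tau_topology_def topology_generated_by_topspace by auto
  qed
qed

section \<open>Existence of the projection\<close>

text \<open>
  Let \<open>m\<close> be the infimum. The part of \<open>\<Omega>\<close> in the sublevel set at \<open>m + 1\<close> is compact for the pointwise
  topology and meets each of the closed sublevel sets above \<open>m\<close>. As these form a chain, it contains a
  point of all of them, whose divergence is at most \<open>m\<close>.
\<close>
lemma phi_projection_exists:
  assumes \<Omega>: "closedin (tau_topology P) \<Omega>" and fin: "phi_divergence_set \<phi> \<Omega> P < \<infinity>"
  shows "\<exists>Q. is_phi_projection \<phi> P \<Omega> Q"
proof -
  let ?S = "partition_sublevel \<phi> P"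
  define m where "m = enn2real (phi_divergence_set \<phi> \<Omega> P)"
  have m: "ennreal m = phi_divergence_set \<phi> \<Omega> P" "0 \<le> m"
    using fin by (auto simp: m_def)
  have \<Omega>_sub: "\<Omega> \<subseteq> signed_measures P"
    using closedin_subset[OF \<Omega>] by (simp add: topspace_tau_topology)
  have "closedin (top_of_set (?S (m + 1))) {Q \<in> topspace (top_of_set (?S (m + 1))). Q \<in> \<Omega>}"
    using continuous_map_tau_topology \<Omega> by (rule closedin_continuous_map_preimage)
  then have "closedin (top_of_set (?S (m + 1))) {Q \<in> ?S (m + 1). Q \<in> \<Omega>}"
    by simp
  then have "closed {Q \<in> ?S (m + 1). Q \<in> \<Omega>}"
    using closed_partition_sublevel by (rule closedin_closed_trans)
  then have "compact (?S (m + 1) \<inter> {Q \<in> ?S (m + 1). Q \<in> \<Omega>})"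
    using compact_partition_sublevel by (intro compact_Int_closed)
  then have "compact (?S (m + 1) \<inter> \<Omega>)"
    by (rule back_subst[of compact]) auto
  then have "(?S (m + 1) \<inter> \<Omega>) \<inter> (\<Inter>c\<in>{m<..}. ?S c) \<noteq> {}"
  proof (rule compact_imp_fip_image)
    fix I assume I: "finite I" "I \<subseteq> {m<..}"
    define c where "c = Min (insert (m + 1) I)"
    have c: "m < c" "c \<le> m + 1" "\<And>d. d \<in> I \<Longrightarrow> c \<le> d"
      using I by (auto simp: c_def)
    then have "ennreal m < ennreal c"
      using m(2) by (simp add: ennreal_less_iff)
    then have "(INF Q \<in> \<Omega>. phi_divergence \<phi> Q P) < ennreal c"
      by (simp add: m(1) phi_divergence_set_def)
    then obtain Q where Q: "Q \<in> \<Omega>" "phi_divergence \<phi> Q P < ennreal c"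
      by (auto simp: INF_less_iff)
    have "Q \<in> ?S d" if "c \<le> d" for d
    proof -
      have "phi_divergence \<phi> Q P \<le> ennreal d"
        using Q(2) ennreal_leI[OF that] by (simp add: less_imp_le order.trans)
      then show ?thesis
        using Q(1) \<Omega>_sub c m that sublevel_eq_partition_sublevel[of d] by (auto simp: sublevel_def)
    qed
    with Q c show "(?S (m + 1) \<inter> \<Omega>) \<inter> (\<Inter>d\<in>I. ?S d) \<noteq> {}" by blast
  qed (rule closed_partition_sublevel)
  then obtain Q where Q: "Q \<in> \<Omega>" "\<And>c. m < c \<Longrightarrow> Q \<in> ?S c" by auto
  have "phi_divergence \<phi> Q P \<le> ennreal m"
  proof (rule ennreal_le_epsilon)
    fix e :: real assume "0 < e"
    then have "Q \<in> sublevel \<phi> P (m + e)"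
      using Q(2) m(2) by (simp add: sublevel_eq_partition_sublevel)
    then show "phi_divergence \<phi> Q P \<le> ennreal m + ennreal e"
      using m(2) \<open>0 < e\<close> by (simp add: sublevel_def)
  qed
  moreover have "ennreal m \<le> phi_divergence \<phi> Q' P" if "Q' \<in> \<Omega>" for Q'
    unfolding m(1) phi_divergence_set_def using that by (rule INF_lower)
  ultimately have "is_phi_projection \<phi> P \<Omega> Q"
    using Q(1) by (auto simp: is_phi_projection_def intro: order_trans)
  then show ?thesis by blast
qed

end

theorem theorem2p7:
  fixes P :: "'a measure"
    and \<phi> :: "real \<Rightarrow> ennreal"
    and a b :: ereal
    and \<Omega> :: "('a set \<Rightarrow> real) set"
  assumes "prob_space P"
    and "\<exists>x. \<phi> x < \<infinity>"
    and "convex_ennreal \<phi>"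
    and "\<phi> 1 = 0"
    and "a < 1" and "1 < b"
    and "interval_with_endpoints (eff_domain \<phi>) a b"
    and "closed_at_endpoints \<phi> a b"
    and "closedin (tau_topology P) \<Omega>"
    and "phi_divergence_set \<phi> \<Omega> P < \<infinity>"
    and "((\<lambda>x. \<phi> x / ennreal \<bar>x\<bar>) \<longlongrightarrow> \<infinity>) at_infinity"
  shows "\<exists>Q. is_phi_projection \<phi> P \<Omega> Q"
proof -
  obtain C where C: "countable C" "C \<subseteq> affine_minorants \<phi>"
    "\<And>x. \<phi> x = (SUP (s, t) \<in> C. ennreal (s * x + t))"
    using SUP_countable_affine_minorants[OF assms(3-8)] by blast
  define line where "line k = (case k of 0 \<Rightarrow> (0, 0) | Suc j \<Rightarrow> from_nat_into (insert (0, 0) C) j)" for k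
  have enum: "range (from_nat_into (insert (0, 0) C)) = insert (0, 0) C"
    using C(1) by (intro range_from_nat_into) auto
  have "range line = insert (line 0) (range (\<lambda>j. line (Suc j)))"
    by (subst UNIV_nat_eq) (simp only: image_insert image_image)
  then have range_line: "range line = insert (0, 0) C"
    by (simp add: line_def enum)
  interpret affine_envelope P \<phi> "fst \<circ> line" "snd \<circ> line"
  proof (intro affine_envelope.intro affine_envelope_axioms.intro assms(1))
    show "\<phi> x = (SUP k. ennreal ((fst \<circ> line) k * x + (snd \<circ> line) k))" for x
    proof -
      have "(SUP k. ennreal ((fst \<circ> line) k * x + (snd \<circ> line) k)) =
          (SUP p \<in> range line. ennreal (fst p * x + snd p))"
        by (simp add: image_image)
      also have "\<dots> = (SUP p \<in> C. ennreal (fst p * x + snd p))"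
        unfolding range_line by (simp add: sup_absorb2)
      finally show ?thesis
        by (simp add: C(3) case_prod_beta)
    qed
    show "\<exists>u\<ge>0. (m, - u) \<in> affine_minorants \<phi> \<and> (- m, - u) \<in> affine_minorants \<phi>" for m
      using superlinear_affine_minorants[OF assms(11)] by metis
  qed (simp_all add: line_def)
  show ?thesis
    using phi_projection_exists assms(9,10) .
qed

end
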